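(* Let $d\in\mathbb{N}$, let the dominating mixed smoothness $\beta\geq0$, the isotropic smoothness $\alpha>-\beta$ and the refinement $N\geq1$ be given, and let the shape parameter be $T:=-\frac{\alpha}{\beta}$, with $T:=-\infty$ for $\beta=0$. Let $f\in\mathcal{A}^{\alpha,\beta}(\mathbb{T}^d)\cap\mathcal{C}(\mathbb{T}^d)$ and let $\Lambda:=\Lambda(\boldsymbol{z}_1,M_1,\ldots,\boldsymbol{z}_L,M_L)\subset\mathbb{T}^d$ be a multiple rank-1 lattice fulfilling the reconstruction property $\bigcup_{\ell=1}^L I_\ell=I$ for $I=I_N^{d,T}$. Assume additionally that the number $L$ of single rank-1 lattices is bounded by $L\lesssim\log|I_N^{d,T}|$ and that the number of samples $M$ is bounded by $M:=\sum_{\ell=1}^LM_\ell\lesssim|I_N^{d,T}|\log|I_N^{d,T}|$. Then the sampling error is bounded by $$\Vert f - S^{\Lambda}_{ I_N^{d,T}} f\,|\, L_\infty(\mathbb{T}^d) \Vert \leq \Vert f - S^{\Lambda}_{ I_N^{d,T}} f\,|\, \mathcal{A}(\mathbb{T}^d) \Vert \lesssim \Vert f\,|\, \mathcal{A}^{\alpha,\beta}(\mathbb{T}^d) \Vert \,(\log M)\begin{cases} \left(\frac{\log M}{M}\right)^{\frac{\alpha}{d}+\beta} & \text{for } \alpha>0,\ \beta\geq 0,\\ \left(\frac{\log^d M}{M}\right)^{\beta} & \text{for } \beta>\alpha=0,\\ \left(\frac{\log M}{M}\right)^{\alpha+\beta} & \text{for } -\beta<\alpha<0, \end{cases}$$ where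 the constants may depend on the dimension $d$ and the smoothness parameters $\alpha,\beta$.
   Context: Function spaces: $\mathbb{T}^d\simeq[0,1)^d$ is the $d$-dimensional torus, $\mathcal{C}(\mathbb{T}^d)$ is the space of continuous functions $\mathbb{T}^d\to\mathbb{C}$, and $\hat f_{\boldsymbol{k}}:=\int_{\mathbb{T}^d}f(\boldsymbol{x})\,\mathrm{e}^{-2\pi\mathrm{i}\boldsymbol{k}\cdot\boldsymbol{x}}\,\mathrm{d}\boldsymbol{x}$, $\boldsymbol{k}\in\mathbb{Z}^d$. The weights are $\omega^{\alpha,\beta}(\boldsymbol{k}):=\max(1,\Vert\boldsymbol{k}\Vert_1)^\alpha\prod_{s=1}^d\max(1,|k_s|)^\beta$. For $\beta\ge0$, $\alpha\ge-\beta$, $\mathcal{A}^{\alpha,\beta}(\mathbb{T}^d):=\{f\in L_1(\mathbb{T}^d):\Vert f|\mathcal{A}^{\alpha,\beta}(\mathbb{T}^d)\Vert:=\sum_{\boldsymbol{k}\in\mathbb{Z}^d}\omega^{\alpha,\beta}(\boldsymbol{k})|\hat f_{\boldsymbol{k}}|<\infty\}$, and $\mathcal{A}(\mathbb{T}^d):=\mathcal{A}^{0,0}(\mathbb{T}^d)$. Index sets: for $N\ge1$ and $T\in(-\infty,1)$, $I_N^{d,T}:=\{\boldsymbol{k}\in\mathbb{Z}^d:\omega^{-T,1}(\boldsymbol{k})=\max(1,\Vert\boldsymbol{k}\Vert_1)^{-T}\prod_{s=1}^d\max(1,|k_s|)\le N^{1-T}\}$, and $I_N^{d,-\infty}:=\{\boldsymbol{k}\in\mathbb{Z}^d:\max(1,\Vert\boldsymbol{k}\Vert_1)\le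 N\}$. These sets are finite. Lattices: for $L\in\mathbb{N}$, $\boldsymbol{z}_\ell\in\mathbb{Z}^d$, $M_\ell\in\mathbb{N}$, the rank-1 lattice is $\Lambda(\boldsymbol{z}_\ell,M_\ell):=\{\frac{j}{M_\ell}\boldsymbol{z}_\ell\bmod\boldsymbol{1}: j=0,\ldots,M_\ell-1\}\subset\mathbb{T}^d$, and the multiple rank-1 lattice is $\Lambda(\boldsymbol{z}_1,M_1,\ldots,\boldsymbol{z}_L,M_L):=\bigcup_{\ell=1}^L\Lambda(\boldsymbol{z}_\ell,M_\ell)$. Reconstruction property: for a finite $I\subset\mathbb{Z}^d$ let $I_\ell:=\{\boldsymbol{k}\in I:\boldsymbol{k}\cdot\boldsymbol{z}_\ell\not\equiv\boldsymbol{k}'\cdot\boldsymbol{z}_\ell\ (\mathrm{mod}\ M_\ell)\text{ for all }\boldsymbol{k}'\in I\setminus\{\boldsymbol{k}\}\}$. $\Lambda$ fulfills the reconstruction property for $I$ if $\bigcup_{\ell=1}^LI_\ell=I$. Sampling operator: for $\boldsymbol{k}\in I$ let $\mathcal{L}^\Lambda_{\boldsymbol{k}}:=\{\ell\in\{1,\ldots,L\}:\boldsymbol{k}\in I_\ell\}$ (nonempty under the reconstruction property). For continuous $f$ put $\hat f_{\boldsymbol{k}}^{\Lambda(\boldsymbol{z}_\ell,M_\ell)}:=\frac1{M_\ell}\sum_{j=0}^{M_\ell-1}f(\frac{j}{M_\ell}\boldsymbol{z}_\ell\bmod\boldsymbol{1})\,\mathrm{e}^{-2\pi\mathrm{i}j\boldsymbol{k}\cdot\boldsymbol{z}_\ell/M_\ell}$,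 $\hat f_{\boldsymbol{k}}^\Lambda:=\frac1{|\mathcal{L}^\Lambda_{\boldsymbol{k}}|}\sum_{\ell\in\mathcal{L}^\Lambda_{\boldsymbol{k}}}\hat f_{\boldsymbol{k}}^{\Lambda(\boldsymbol{z}_\ell,M_\ell)}$, and $S_I^\Lambda f:=\sum_{\boldsymbol{k}\in I}\hat f_{\boldsymbol{k}}^\Lambda\,\mathrm{e}^{2\pi\mathrm{i}\boldsymbol{k}\cdot\circ}$, where $\circ$ denotes the function argument. Asymptotic notation: $a\lesssim b$ means $a\le Cb$ with a constant $C>0$ independent of $N$, $f$ and $\Lambda$. The constants in the two assumed bounds on $L$ and $M$ are fixed in advance; the constant in the conclusion may depend on them in addition to the listed parameters. $\log^dM$ means $(\log M)^d$. *)

theory Defs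
  imports "HOL-Analysis.Analysis" "HOL-Probability.Essential_Supremum" "HOL-Number_Theory.Cong"
begin

text \<open>
  The dimension is \<open>CARD('d)\<close>. A function on the torus is represented by a function on
  \<open>real ^ 'd\<close> that is 1-periodic in every coordinate. Integrals and essential suprema are taken
  with respect to Lebesgue measure on the fundamental domain \<open>[0,1)^d\<close>, and a
  point modulo 1 is represented in this domain.
\<close>

definition unit_cube :: "(real ^ 'd::finite) set"
  where "unit_cube = {x. \<forall>s. 0 \<le> x $ s \<and> x $ s < 1}"

definition real_vec :: "int ^ 'd \<Rightarrow> real ^ 'd::finite"
  where "real_vec k = (\<chi> s. real_of_int (k $ s))"

definition periodic :: "(real ^ 'd::finite \<Rightarrow> complex) \<Rightarrow> bool"
  where "periodic f \<longleftrightarrow> (\<forall>x k. f (x + real_vec k) = f x)"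

definition continuous_torus :: "(real ^ 'd::finite \<Rightarrow> complex) set"
  where "continuous_torus = {f. periodic f \<and> continuous_on UNIV f}"

definition Linf_norm :: "(real ^ 'd::finite \<Rightarrow> complex) \<Rightarrow> ennreal"
  where "Linf_norm f = esssup (lebesgue_on unit_cube) (\<lambda>x. ennreal (norm (f x)))"

definition fourier_coeff :: "(real ^ 'd::finite \<Rightarrow> complex) \<Rightarrow> int ^ 'd \<Rightarrow> complex"
  where "fourier_coeff f k =
    integral\<^sup>L (lebesgue_on unit_cube)
      (\<lambda>x. f x * exp (- (2 * complex_of_real pi * \<i> * complex_of_real (real_vec k \<bullet> x))))"

definition one_norm :: "int ^ 'd::finite \<Rightarrow> real"
  where "one_norm k = (\<Sum>s\<in>UNIV. \<bar>real_of_int (k $ s)\<bar>)"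

definition weight :: "real \<Rightarrow> real \<Rightarrow> int ^ 'd::finite \<Rightarrow> real"
  where "weight \<alpha> \<beta> k =
    max 1 (one_norm k) powr \<alpha> * (\<Prod>s\<in>UNIV. max 1 \<bar>real_of_int (k $ s)\<bar> powr \<beta>)"

text \<open>
  The norm takes values in the extended nonnegative reals, so that it is \<open>\<infinity>\<close> for a divergent
  series.
\<close>

definition wiener_norm :: "real \<Rightarrow> real \<Rightarrow> (real ^ 'd::finite \<Rightarrow> complex) \<Rightarrow> ennreal"
  where "wiener_norm \<alpha> \<beta> f =
    (\<Sum>\<^sub>\<infinity>k\<in>UNIV. ennreal (weight \<alpha> \<beta> k * norm (fourier_coeff f k)))"

definition wiener_space :: "real \<Rightarrow> real \<Rightarrow> (real ^ 'd::finite \<Rightarrow> complex) set"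
  where "wiener_space \<alpha> \<beta> =
    {f. periodic f \<and> integrable (lebesgue_on unit_cube) f \<and> wiener_norm \<alpha> \<beta> f < \<infinity>}"

text \<open>The shape parameter ranges over \<open>[-\<infinity>, 1)\<close>.\<close>

definition index_set :: "real \<Rightarrow> ereal \<Rightarrow> (int ^ 'd::finite) set"
  where "index_set N T =
    (if T = -\<infinity> then {k. max 1 (one_norm k) \<le> N}
     else {k. weight (- real_of_ereal T) 1 k \<le> N powr (1 - real_of_ereal T)})"

definition shape :: "real \<Rightarrow> real \<Rightarrow> ereal"
  where "shape \<alpha> \<beta> = (if \<beta> = 0 then -\<infinity> else ereal (- \<alpha> / \<beta>))"

text \<open>
  A multiple rank-1 lattice is given by its number \<open>L\<close> of single lattices, the generating vectors
  \<open>z 1, \<dots>, z L\<close> and the sizes \<open>M 1, \<dots>, M L\<close>: the reconstruction property and the sampling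
  operator depend on these data and not only on the set of nodes.
\<close>

definition lattice_node :: "int ^ 'd::finite \<Rightarrow> nat \<Rightarrow> nat \<Rightarrow> real ^ 'd"
  where "lattice_node z m j = (\<chi> s. frac (real j / real m * real_of_int (z $ s)))"

definition int_dot :: "int ^ 'd::finite \<Rightarrow> int ^ 'd \<Rightarrow> int"
  where "int_dot k z = (\<Sum>s\<in>UNIV. k $ s * z $ s)"

definition alias_free :: "(int ^ 'd::finite) set \<Rightarrow> int ^ 'd \<Rightarrow> nat \<Rightarrow> (int ^ 'd) set"
  where "alias_free I z m =
    {k \<in> I. \<forall>k' \<in> I - {k}. \<not> [int_dot k z = int_dot k' z] (mod int m)}"

definition reconstruction_property ::
    "(int ^ 'd::finite) set \<Rightarrow> nat \<Rightarrow> (nat \<Rightarrow> int ^ 'd) \<Rightarrow> (nat \<Rightarrow> nat) \<Rightarrow> bool"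
  where "reconstruction_property I L z M \<longleftrightarrow> (\<Union>l\<in>{1..L}. alias_free I (z l) (M l)) = I"

definition lattice_coeff ::
    "int ^ 'd::finite \<Rightarrow> nat \<Rightarrow> (real ^ 'd \<Rightarrow> complex) \<Rightarrow> int ^ 'd \<Rightarrow> complex"
  where "lattice_coeff z m f k =
    1 / of_nat m * (\<Sum>j<m. f (lattice_node z m j) *
      exp (- (2 * complex_of_real pi * \<i> * of_nat j * of_int (int_dot k z) / of_nat m)))"

definition alias_free_lattices ::
    "(int ^ 'd::finite) set \<Rightarrow> nat \<Rightarrow> (nat \<Rightarrow> int ^ 'd) \<Rightarrow> (nat \<Rightarrow> nat) \<Rightarrow> int ^ 'd \<Rightarrow> nat set"
  where "alias_free_lattices I L z M k = {l \<in> {1..L}. k \<in> alias_free I (z l) (M l)}"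

definition multi_lattice_coeff ::
    "(int ^ 'd::finite) set \<Rightarrow> nat \<Rightarrow> (nat \<Rightarrow> int ^ 'd) \<Rightarrow> (nat \<Rightarrow> nat) \<Rightarrow>
      (real ^ 'd \<Rightarrow> complex) \<Rightarrow> int ^ 'd \<Rightarrow> complex"
  where "multi_lattice_coeff I L z M f k =
    1 / of_nat (card (alias_free_lattices I L z M k)) *
      (\<Sum>l\<in>alias_free_lattices I L z M k. lattice_coeff (z l) (M l) f k)"

definition sampling_op ::
    "(int ^ 'd::finite) set \<Rightarrow> nat \<Rightarrow> (nat \<Rightarrow> int ^ 'd) \<Rightarrow> (nat \<Rightarrow> nat) \<Rightarrow>
      (real ^ 'd \<Rightarrow> complex) \<Rightarrow> real ^ 'd \<Rightarrow> complex"
  where "sampling_op I L z M f x =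
    (\<Sum>k\<in>I. multi_lattice_coeff I L z M f k *
      exp (2 * complex_of_real pi * \<i> * complex_of_real (real_vec k \<bullet> x)))"

end

theory Submission imports Defs begin

text \<open>
  Write \<open>w\<close> for \<open>weight \<alpha> \<beta>\<close>. For every admissible shape parameter the index set is a sublevel
  set of the weight of the function space itself, \<open>I = {k. w k \<le> N powr (\<alpha> + \<beta>)}\<close>
  (\<open>index_set_eq\<close>). The frequencies outside \<open>I\<close> therefore satisfy
  \<open>\<Sum>\<^bsub>k \<notin> I\<^esub> |f\<^sub>k| \<le> N powr (- (\<alpha> + \<beta>)) * \<parallel>f\<parallel>\<close>, where \<open>f\<^sub>k\<close> are the Fourier coefficients of \<open>f\<close> and the
  norm is the weighted one (\<open>tail_le_weighted_norm\<close>).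

  The sampling error is at most \<open>1 + L\<close> times this tail (\<open>sampling_error_le_tail\<close>). The function \<open>f\<close> is
  the pointwise sum of its Fourier series, so every computed coefficient is the sum of \<open>f\<^sub>h\<close> times the
  coefficient computed for the character with frequency \<open>h\<close>. A single lattice computes 1 if \<open>h\<close> and \<open>k\<close>
  alias and 0 otherwise. For \<open>h\<close> in \<open>I\<close> the averages over the lattices that reconstruct \<open>k\<close> are exact.
  For arbitrary \<open>h\<close>, each of the \<open>L\<close> lattices maps \<open>h\<close> to at most one of the frequencies that
  it reconstructs, so that the coefficients computed from the character \<open>h\<close> add up to at most \<open>L\<close>.

  It remains to express \<open>(1 + L) * N powr (- (\<alpha> + \<beta>))\<close> by the number \<open>M\<close> of samples. Since a lattice
  of size \<open>m\<close> can distinguish at most \<open>m\<close> frequencies, \<open>|I| \<le> M\<close>. Hence \<open>L\<close> is bounded by a multiple of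
  \<open>ln M\<close>, and the assumed bound on \<open>M\<close> gives \<open>1 / |I| \<le> c * ln M / M\<close>. An upper bound of \<open>|I|\<close> in terms of
  \<open>N\<close> now yields the rate (\<open>cutoff_le_rate\<close>). With \<open>R = N powr (\<alpha> + \<beta>)\<close>, the cardinality of \<open>I\<close> is bounded by a
  multiple of \<open>R powr (1 / (\<alpha> / d + \<beta>))\<close> for \<open>\<alpha> > 0\<close>, of \<open>N * (1 + ln N) ^ (d - 1)\<close> for \<open>\<alpha> = 0\<close> and of \<open>N\<close> for
  \<open>\<alpha> < 0\<close>: the three cases of the theorem are the three regimes of this lattice point count.

  The bound of the supremum norm holds because the error is itself a continuous periodic function with
  absolutely summable Fourier coefficients, hence equal to its Fourier series. This rests on the
  uniqueness theorem for Fourier coefficients of continuous functions (\<open>fourier_uniqueness\<close>), which is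
  proved by testing against powers of a trigonometric polynomial with a single peak.
\<close>

section \<open>Lattice points in the sublevel sets of the weight\<close>

definition truncated_abs :: "int \<Rightarrow> real"
  where "truncated_abs j = max 1 \<bar>real_of_int j\<bar>"

lemma truncated_abs_ge_1: "1 \<le> truncated_abs j"
  by (simp add: truncated_abs_def)

lemma truncated_abs_pos: "0 < truncated_abs j"
  using truncated_abs_ge_1[of j] by linarith

lemma truncated_abs_0 [simp]: "truncated_abs 0 = 1"
  by (simp add: truncated_abs_def)

lemma truncated_abs_minus [simp]: "truncated_abs (- j) = truncated_abs j"
  by (simp add: truncated_abs_def)

lemma abs_le_of_truncated_abs_le: "truncated_abs j \<le> Y \<Longrightarrow> \<bar>real_of_int j\<bar> \<le> Y"
  by (simp add: truncated_abs_def)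

lemma weight_eq:
  "weight \<alpha> \<beta> k = max 1 (one_norm k) powr \<alpha> * (\<Prod>s\<in>UNIV. truncated_abs (k $ s)) powr \<beta>"
  unfolding weight_def truncated_abs_def by (subst prod_powr_distrib) auto

lemma truncated_abs_le_one_norm: "truncated_abs (k $ s) \<le> max 1 (one_norm k)"
proof -
  have "\<bar>real_of_int (k $ s)\<bar> \<le> one_norm k"
    unfolding one_norm_def by (rule member_le_sum) auto
  then show ?thesis by (auto simp: truncated_abs_def)
qed

lemma prod_truncated_abs_ge: "truncated_abs (k $ s) \<le> (\<Prod>t\<in>UNIV. truncated_abs (k $ t))"
proof -
  have "truncated_abs (k $ s) * 1 \<le> truncated_abs (k $ s) * (\<Prod>t\<in>UNIV-{s}. truncated_abs (k $ t))"
    using truncated_abs_pos[of "k $ s"]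
    by (intro mult_left_mono prod_ge_1) (auto simp: truncated_abs_ge_1)
  also have "\<dots> = (\<Prod>t\<in>UNIV. truncated_abs (k $ t))"
    by (subst prod.remove[of UNIV s]) auto
  finally show ?thesis by simp
qed

lemma weight_0_eq: "weight 0 \<beta> k = (\<Prod>s\<in>UNIV. truncated_abs (k $ s)) powr \<beta>"
proof -
  have "max 1 (one_norm k) \<noteq> 0" by linarith
  then show ?thesis unfolding weight_eq by simp
qed

lemma weight_pos: "0 < weight \<alpha> \<beta> k"
  by (auto simp: weight_def intro!: mult_pos_pos prod_pos)

lemma exists_largest_component: "\<exists>s. \<forall>t. truncated_abs (k $ t) \<le> truncated_abs (k $ s)"
proof -
  let ?A = "range (\<lambda>s. truncated_abs (k $ s))"
  have "Max ?A \<in> ?A" by (rule Max_in) auto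
  then obtain s where "Max ?A = truncated_abs (k $ s)" by (rule imageE)
  moreover have "truncated_abs (k $ t) \<le> Max ?A" for t by simp
  ultimately have "truncated_abs (k $ t) \<le> truncated_abs (k $ s)" for t by metis
  then show ?thesis by blast
qed

lemma vec_box_bij:
  "bij_betw vec_lambda (PiE UNIV A) {k. \<forall>t. k $ t \<in> A t}"
  by (rule bij_betwI[where g = vec_nth]) (auto simp: PiE_def Pi_def)

lemma finite_vec_box:
  fixes A :: "'d::finite \<Rightarrow> 'b set"
  assumes "\<And>t. finite (A t)"
  shows "finite {k :: 'b ^ 'd. \<forall>t. k $ t \<in> A t}"
  using bij_betw_finite[OF vec_box_bij[of A]] finite_PiE[of UNIV A] assms by auto

lemma sum_vec_box:
  fixes A :: "'d::finite \<Rightarrow> 'b set" and g :: "'d \<Rightarrow> 'b \<Rightarrow> real"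
  assumes "\<And>t. finite (A t)"
  shows "(\<Sum>k\<in>{k :: 'b ^ 'd. \<forall>t. k $ t \<in> A t}. \<Prod>t\<in>UNIV. g t (k $ t)) = (\<Prod>t\<in>UNIV. \<Sum>j\<in>A t. g t j)"
proof -
  have "(\<Prod>t\<in>UNIV. \<Sum>j\<in>A t. g t j) = (\<Sum>h\<in>PiE UNIV A. \<Prod>t\<in>UNIV. g t (h t))"
    by (rule prod_sum_PiE) (use assms in auto)
  also have "\<dots> = (\<Sum>k\<in>{k :: 'b ^ 'd. \<forall>t. k $ t \<in> A t}. \<Prod>t\<in>UNIV. g t (k $ t))"
    by (subst sum.reindex_bij_betw[OF vec_box_bij[of A], symmetric]) simp
  finally show ?thesis by simp
qed

lemma prod_except_one:
  fixes a b :: real and s :: "'d::finite"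
  shows "(\<Prod>t\<in>UNIV. if t = s then a else b) = a * b ^ (CARD('d) - 1)"
proof -
  have "(\<Prod>t\<in>UNIV. if t = s then a else b) = a * (\<Prod>t\<in>UNIV - {s}. if t = s then a else b)"
    by (subst prod.remove[of UNIV s]) auto
  also have "(\<Prod>t\<in>UNIV - {s}. if t = s then a else b) = (\<Prod>t\<in>UNIV - {s}. b)"
    by (rule prod.cong) auto
  finally show ?thesis by (simp add: card_Diff_singleton)
qed

lemma sum_even_int_interval:
  fixes g :: "int \<Rightarrow> real"
  assumes "\<And>j. g (- j) = g j"
  shows "sum g {- int n..int n} = g 0 + 2 * (\<Sum>i=1..n. g (int i))"
proof (induction n)
  case (Suc n)
  have "{- int (Suc n)..int (Suc n)} = insert (int (Suc n)) (insert (- int (Suc n)) {- int n..int n})"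
    by auto
  then show ?case using Suc assms[of "int (Suc n)"] by simp
qed simp

text \<open>
  The mean value theorem for \<open>u powr q\<close>, whose derivative decreases in absolute value because \<open>q < 1\<close>.
  For \<open>q > 0\<close> it makes the partial sums of \<open>i powr (q - 1)\<close> telescope against an increasing power, for
  \<open>q < 0\<close> the tails against a decreasing one; the absolute values cover both.
\<close>

lemma powr_difference_ge:
  fixes x q :: real
  assumes "x > 0" "q < 1"
  shows "\<bar>q\<bar> * (x + 1) powr (q - 1) \<le> \<bar>(x + 1) powr q - x powr q\<bar>"
proof -
  obtain \<xi> where \<xi>: "x < \<xi>" "\<xi> < x + 1"
      "(x + 1) powr q - x powr q = (x + 1 - x) * (q * \<xi> powr (q - 1))"
    using MVT2[of x "x + 1" "\<lambda>u. u powr q" "\<lambda>u. q * u powr (q - 1)"] assms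
    by (force intro!: DERIV_powr derivative_eq_intros)
  have "(x + 1) powr (q - 1) \<le> \<xi> powr (q - 1)"
    using \<xi> assms by (intro powr_mono2') auto
  then show ?thesis using \<xi>(3) by (simp add: abs_mult mult_left_mono)
qed

lemma sum_powr_head_le:
  assumes "0 \<le> \<gamma>" "\<gamma> < 1" "1 \<le> n"
  shows "(\<Sum>i=1..n. real i powr (- \<gamma>)) \<le> real n powr (1 - \<gamma>) / (1 - \<gamma>)"
  using assms(3)
proof (induction n rule: nat_induct_at_least)
  case base
  then show ?case using assms by (simp add: field_simps)
next
  case (Suc n)
  have m: "real n powr (1 - \<gamma>) \<le> (real n + 1) powr (1 - \<gamma>)"
    using assms by (intro powr_mono2) auto
  have "(1 - \<gamma>) * (real n + 1) powr (- \<gamma>) \<le> (real n + 1) powr (1 - \<gamma>) - real n powr (1 - \<gamma>)"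
  proof (cases "\<gamma> = 0")
    case False
    then have "1 - \<gamma> < 1" using assms by simp
    from powr_difference_ge[of "real n", OF _ this] Suc m assms show ?thesis by simp
  qed (use Suc in simp)
  then have "(real n + 1) powr (- \<gamma>) \<le> ((real n + 1) powr (1 - \<gamma>) - real n powr (1 - \<gamma>)) / (1 - \<gamma>)"
    using assms by (simp only: pos_le_divide_eq diff_gt_0_iff_gt mult.commute)
  then show ?case using Suc by (simp add: add.commute diff_divide_distrib)
qed

lemma sum_powr_tail_le:
  assumes "1 < p" "1 \<le> m" "m \<le> n"
  shows "(\<Sum>i\<in>{m<..n}. real i powr (- p)) \<le> (real m powr (1 - p) - real n powr (1 - p)) / (p - 1)"
  using assms(3)
proof (induction n rule: nat_induct_at_least)
  case (Suc n)
  have m: "(real n + 1) powr (1 - p) \<le> real n powr (1 - p)"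
    using assms Suc by (intro powr_mono2') auto
  have "(p - 1) * (real n + 1) powr (- p) \<le> real n powr (1 - p) - (real n + 1) powr (1 - p)"
    using powr_difference_ge[of "real n" "1 - p"] Suc m assms by simp
  then have "(real n + 1) powr (- p) \<le> (real n powr (1 - p) - (real n + 1) powr (1 - p)) / (p - 1)"
    using assms by (simp only: pos_le_divide_eq diff_gt_0_iff_gt mult.commute)
  moreover have "{m<..Suc n} = insert (Suc n) {m<..n}" using Suc by auto
  ultimately show ?case using Suc by (simp add: add.commute diff_divide_distrib)
qed simp

lemma int_head_sum_le:
  assumes "0 \<le> \<gamma>" "\<gamma> < 1"
  shows "\<exists>C>0. \<forall>j::int. (\<Sum>i\<in>{- \<bar>j\<bar>..\<bar>j\<bar>}. truncated_abs i powr (- \<gamma>)) \<le> C * truncated_abs j powr (1 - \<gamma>)"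
proof (intro exI conjI allI)
  let ?C = "1 + 2 / (1 - \<gamma>)"
  show "0 < ?C" using assms by (simp add: add_pos_nonneg)
  fix j :: int
  define n where "n = nat \<bar>j\<bar>"
  have "(\<Sum>i\<in>{- \<bar>j\<bar>..\<bar>j\<bar>}. truncated_abs i powr (- \<gamma>)) = (\<Sum>i\<in>{- int n..int n}. truncated_abs i powr (- \<gamma>))"
    by (simp add: n_def)
  also have "\<dots> = 1 + 2 * (\<Sum>i=1..n. truncated_abs (int i) powr (- \<gamma>))"
    by (subst sum_even_int_interval) auto
  also have "(\<Sum>i=1..n. truncated_abs (int i) powr (- \<gamma>)) = (\<Sum>i=1..n. real i powr (- \<gamma>))"
    by (rule sum.cong) (auto simp: truncated_abs_def)
  also have "\<dots> \<le> truncated_abs j powr (1 - \<gamma>) / (1 - \<gamma>)"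
  proof (cases "n = 0")
    case False
    then have "real n = truncated_abs j" unfolding n_def truncated_abs_def by simp
    then show ?thesis using sum_powr_head_le[OF assms, of n] False by simp
  qed (use assms in simp)
  finally have "(\<Sum>i\<in>{- \<bar>j\<bar>..\<bar>j\<bar>}. truncated_abs i powr (- \<gamma>)) \<le> 1 + 2 * (truncated_abs j powr (1 - \<gamma>) / (1 - \<gamma>))"
    by simp
  moreover have "1 \<le> truncated_abs j powr (1 - \<gamma>)"
    using assms truncated_abs_ge_1 by (intro ge_one_powr_ge_zero) auto
  ultimately show "(\<Sum>i\<in>{- \<bar>j\<bar>..\<bar>j\<bar>}. truncated_abs i powr (- \<gamma>)) \<le> ?C * truncated_abs j powr (1 - \<gamma>)"
    by (simp add: algebra_simps)
qed

lemma int_tail_sum_le: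
  assumes "1 < p"
  shows "\<exists>C>0. \<forall>X\<ge>1. \<forall>J. finite J \<longrightarrow> (\<forall>j\<in>J. X < \<bar>real_of_int j\<bar>) \<longrightarrow>
     (\<Sum>j\<in>J. truncated_abs j powr (- p)) \<le> C * X powr (1 - p)"
proof (intro exI conjI allI impI)
  let ?C = "2 / (p - 1) * (1/2) powr (1 - p)"
  show "0 < ?C" using assms by simp
  fix X :: real and J :: "int set"
  assume X: "1 \<le> X" and J: "finite J" "\<forall>j\<in>J. X < \<bar>real_of_int j\<bar>"
  define m where "m = nat \<lfloor>X\<rfloor>"
  have m: "1 \<le> m" "real m \<le> X" "X < real m + 1" using X unfolding m_def by linarith+
  obtain n0 where n0: "\<forall>j\<in>J. nat \<bar>j\<bar> \<le> n0"
    using finite_nat_set_iff_bounded_le[of "(\<lambda>j. nat \<bar>j\<bar>) ` J"] J by auto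
  define n where "n = max n0 m"
  let ?g = "\<lambda>j. truncated_abs j powr (- p)"
  have sub: "J \<subseteq> {- int n..int n} - {- int m..int m}"
  proof
    fix j assume "j \<in> J"
    then have "nat \<bar>j\<bar> \<le> n" "X < \<bar>real_of_int j\<bar>" using n0 J unfolding n_def by auto
    moreover have "\<not> \<bar>j\<bar> \<le> int m"
      using \<open>X < \<bar>real_of_int j\<bar>\<close> m(2) by linarith
    ultimately show "j \<in> {- int n..int n} - {- int m..int m}" by auto
  qed
  have "(\<Sum>j\<in>J. ?g j) \<le> sum ?g ({- int n..int n} - {- int m..int m})"
    by (rule sum_mono2) (use sub in auto)
  also have "\<dots> = sum ?g {- int n..int n} - sum ?g {- int m..int m}"
    by (rule sum_diff) (auto simp: n_def)
  also have "\<dots> = 2 * ((\<Sum>i=1..n. ?g (int i)) - (\<Sum>i=1..m. ?g (int i)))"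
    by (subst (1 2) sum_even_int_interval) auto
  also have "(\<Sum>i=1..n. ?g (int i)) - (\<Sum>i=1..m. ?g (int i)) = (\<Sum>i\<in>{1..n} - {1..m}. ?g (int i))"
    by (rule sum_diff[symmetric]) (auto simp: n_def)
  also have "{1..n} - {1..m} = {m<..n}" by auto
  also have "2 * (\<Sum>i\<in>{m<..n}. ?g (int i)) \<le> 2 * ((1/2) powr (1 - p) * X powr (1 - p) / (p - 1))"
  proof -
    have "(\<Sum>i\<in>{m<..n}. ?g (int i)) = (\<Sum>i\<in>{m<..n}. real i powr (- p))"
      by (rule sum.cong) (auto simp: truncated_abs_def)
    also have "\<dots> \<le> (real m powr (1 - p) - real n powr (1 - p)) / (p - 1)"
      by (rule sum_powr_tail_le) (use assms m in \<open>auto simp: n_def\<close>)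
    also have "\<dots> \<le> real m powr (1 - p) / (p - 1)"
      using assms by (intro divide_right_mono) auto
    also have "\<dots> \<le> (1/2 * X) powr (1 - p) / (p - 1)"
    proof -
      have "1 \<le> real m" using m(1) by simp
      then have "1/2 * X \<le> real m" using m(3) by simp
      then show ?thesis using X assms by (intro divide_right_mono powr_mono2') auto
    qed
    also have "(1/2 * X) powr (1 - p) = (1/2) powr (1 - p) * X powr (1 - p)"
      using X by (subst powr_mult) auto
    finally show ?thesis by simp
  qed
  finally show "(\<Sum>j\<in>J. ?g j) \<le> ?C * X powr (1 - p)" by simp
qed

text \<open>
  The factor 3 absorbs the integer 0 and the two signs, since a nonempty \<open>J\<close> forces \<open>Y \<ge> 1\<close>.
\<close>

lemma card_truncated_abs_le:
  assumes "0 \<le> Y" "\<And>j. j \<in> J \<Longrightarrow> truncated_abs j \<le> Y"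
  shows "real (card J) \<le> 3 * Y"
proof (cases "J = {}")
  case False
  then have Y: "1 \<le> Y" using assms(2) truncated_abs_ge_1 by (meson all_not_in_conv order_trans)
  have "J \<subseteq> {- \<lfloor>Y\<rfloor>..\<lfloor>Y\<rfloor>}"
  proof
    fix j assume "j \<in> J"
    from abs_le_of_truncated_abs_le[OF assms(2)[OF this]] show "j \<in> {- \<lfloor>Y\<rfloor>..\<lfloor>Y\<rfloor>}"
      by (simp add: le_floor_iff) linarith
  qed
  then have "card J \<le> card {- \<lfloor>Y\<rfloor>..\<lfloor>Y\<rfloor>}" by (intro card_mono) auto
  moreover have "real (card {- \<lfloor>Y\<rfloor>..\<lfloor>Y\<rfloor>}) \<le> 3 * Y" using Y by simp linarith
  ultimately show ?thesis by linarith
qed (use assms in simp)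

text \<open>
  Counting by projection along the coordinate \<open>s\<close>. Above each projected point the bound confines the
  coordinate \<open>s\<close> to an interval whose length is at most \<open>2 * B\<close> times a product of powers of the other coordinates,
  and the sum of such products over a box factors. Counting the coordinate \<open>s\<close> directly, not by another sum of
  reciprocals, is what avoids an additional logarithm.
\<close>

lemma card_le_by_fibers:
  fixes F :: "(int ^ 'd::finite) set" and s :: 'd
  assumes F: "finite F" and A: "finite A" "\<And>k t. k \<in> F \<Longrightarrow> k $ t \<in> A" and B: "0 \<le> B"
    and le: "\<And>k. k \<in> F \<Longrightarrow> truncated_abs (k $ s) * (\<Prod>t\<in>UNIV - {s}. truncated_abs (k $ t) powr p) \<le> B"
  shows "real (card F) \<le> 3 * B * (\<Sum>j\<in>A. truncated_abs j powr (- p)) ^ (CARD('d) - 1)"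
proof -
  define \<pi> :: "int ^ 'd \<Rightarrow> int ^ 'd" where "\<pi> k = (\<chi> t. if t = s then 0 else k $ t)" for k
  define h where "h k = (\<Prod>t\<in>UNIV. if t = s then 1 else truncated_abs (k $ t) powr (- p))"
    for k :: "int ^ 'd"
  define S where "S = {k :: int ^ 'd. \<forall>t. k $ t \<in> (if t = s then {0} else A)}"
  have h_nn: "0 \<le> h k" for k unfolding h_def by (intro prod_nonneg) auto
  have fiber: "real (card {k \<in> F. \<pi> k = k'}) \<le> 3 * (B * h k')" if "k' \<in> \<pi> ` F" for k'
  proof -
    have inj: "inj_on (\<lambda>k. k $ s) {k \<in> F. \<pi> k = k'}"
    proof (rule inj_onI)
      fix k l assume *: "k \<in> {k \<in> F. \<pi> k = k'}" "l \<in> {k \<in> F. \<pi> k = k'}" "k $ s = l $ s"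
      then have "\<pi> k = \<pi> l" by simp
      then have "(if t = s then 0 else k $ t) = (if t = s then 0 else l $ t)" for t
        unfolding \<pi>_def vec_eq_iff by simp
      then show "k = l" using *(3) unfolding vec_eq_iff by metis
    qed
    have "card {k \<in> F. \<pi> k = k'} = card ((\<lambda>k. k $ s) ` {k \<in> F. \<pi> k = k'})"
      using inj by (simp add: card_image)
    also have "real \<dots> \<le> 3 * (B * h k')"
    proof (rule card_truncated_abs_le)
      show "0 \<le> B * h k'" using B h_nn by simp
      fix j assume "j \<in> (\<lambda>k. k $ s) ` {k \<in> F. \<pi> k = k'}"
      then obtain k where k: "k \<in> F" "\<pi> k = k'" "j = k $ s" by auto
      have "h k' = (\<Prod>t\<in>UNIV - {s}. if t = s then 1 else truncated_abs (k' $ t) powr (- p))"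
        unfolding h_def by (subst prod.remove[of UNIV s]) auto
      also have "\<dots> = (\<Prod>t\<in>UNIV - {s}. inverse (truncated_abs (k $ t) powr p))"
        by (rule prod.cong) (auto simp: k(2)[symmetric] \<pi>_def powr_minus)
      also have "\<dots> = inverse (\<Prod>t\<in>UNIV - {s}. truncated_abs (k $ t) powr p)"
        by (simp add: prod_inversef[symmetric] comp_def)
      finally have h: "h k' = inverse (\<Prod>t\<in>UNIV - {s}. truncated_abs (k $ t) powr p)" .
      have "(\<Prod>t\<in>UNIV - {s}. truncated_abs (k $ t) powr p) > 0"
        by (intro prod_pos) (use truncated_abs_pos in \<open>auto simp: less_le\<close>)
      then show "truncated_abs j \<le> B * h k'"
        using le[OF k(1)] unfolding h k(3) by (simp add: field_simps)
    qed
    finally show ?thesis .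
  qed
  have "real (card F) = (\<Sum>k\<in>F. 1)" by simp
  also have "\<dots> = (\<Sum>k'\<in>\<pi> ` F. \<Sum>k\<in>{k \<in> F. \<pi> k = k'}. 1)" by (rule sum.image_gen[OF F])
  also have "\<dots> = (\<Sum>k'\<in>\<pi> ` F. real (card {k \<in> F. \<pi> k = k'}))" by simp
  also have "\<dots> \<le> (\<Sum>k'\<in>\<pi> ` F. 3 * (B * h k'))" by (intro sum_mono fiber)
  also have "\<dots> \<le> (\<Sum>k'\<in>S. 3 * (B * h k'))"
  proof (rule sum_mono2)
    show "finite S" unfolding S_def by (rule finite_vec_box) (use A in auto)
    show "\<pi> ` F \<subseteq> S" using A by (auto simp: S_def \<pi>_def)
  qed (use B h_nn in auto)
  also have "\<dots> = 3 * B * (\<Sum>k'\<in>S. h k')" by (simp add: sum_distrib_left mult.assoc)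
  also have "(\<Sum>k'\<in>S. h k') = (\<Prod>t\<in>UNIV. \<Sum>j\<in>(if t = s then {0} else A). if t = s then 1 else truncated_abs j powr (- p))"
    unfolding S_def h_def by (rule sum_vec_box) (use A in auto)
  also have "\<dots> = (\<Prod>t\<in>UNIV. if t = s then 1 else \<Sum>j\<in>A. truncated_abs j powr (- p))"
    by (rule prod.cong) auto
  also have "\<dots> = 1 * (\<Sum>j\<in>A. truncated_abs j powr (- p)) ^ (CARD('d) - 1)" by (rule prod_except_one)
  finally show ?thesis by simp
qed

text \<open>
  The hyperbolic cross: the fibre count with exponent 1 leaves one harmonic sum for each of the \<open>d - 1\<close>
  remaining coordinates.
\<close>

lemma card_weight_le_mixed:
  assumes "\<beta> > 0"
  shows "\<exists>C>0. \<forall>N\<ge>1. \<forall>F :: (int ^ 'd::finite) set. finite F \<longrightarrow> (\<forall>k\<in>F. weight 0 \<beta> k \<le> N powr \<beta>) \<longrightarrow>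
    real (card F) \<le> C * N * (1 + ln N) ^ (CARD('d) - 1)"
proof (intro exI conjI allI impI ballI)
  let ?C = "3 * 3 ^ (CARD('d) - 1) :: real"
  show "0 < ?C" by simp
  fix N :: real and F :: "(int ^ 'd) set"
  assume N: "1 \<le> N" and F: "finite F" "\<forall>k\<in>F. weight 0 \<beta> k \<le> N powr \<beta>"
  have le: "(\<Prod>t\<in>UNIV. truncated_abs (k $ t)) \<le> N" if "k \<in> F" for k
  proof -
    have "(\<Prod>t\<in>UNIV. truncated_abs (k $ t)) powr \<beta> \<le> N powr \<beta>"
      using F that unfolding weight_0_eq by auto
    then show ?thesis
      using assms N powr_less_mono2[of \<beta> N "\<Prod>t\<in>UNIV. truncated_abs (k $ t)"] by linarith
  qed
  define n where "n = nat \<lfloor>N\<rfloor>"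
  have n: "1 \<le> n" "real n \<le> N" "N < real n + 1" using N unfolding n_def by linarith+
  have harm: "(\<Sum>i=1..n. real i powr (- 1)) \<le> 1 + ln (real n)"
    using n(1)
  proof (induction n rule: nat_induct_at_least)
    case (Suc n)
    have "ln (real n / (real n + 1)) \<le> real n / (real n + 1) - 1"
      using Suc by (intro ln_le_minus_one) auto
    then have "1 / (real n + 1) \<le> ln (real n + 1) - ln (real n)"
      using Suc by (simp add: ln_div field_simps)
    then show ?case using Suc by (simp add: powr_minus inverse_eq_divide add.commute)
  qed simp
  have "(\<Sum>j\<in>{- int n..int n}. truncated_abs j powr (- 1)) = 1 + 2 * (\<Sum>i=1..n. truncated_abs (int i) powr (- 1))"
    by (subst sum_even_int_interval) auto
  also have "(\<Sum>i=1..n. truncated_abs (int i) powr (- 1)) = (\<Sum>i=1..n. real i powr (- 1))"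
    by (rule sum.cong) (auto simp: truncated_abs_def)
  also have "1 + 2 * (\<Sum>i=1..n. real i powr (- 1)) \<le> 3 * (1 + ln N)"
  proof -
    have "ln (real n) \<le> ln N" "0 \<le> ln N" using n by auto
    then show ?thesis using harm by simp
  qed
  finally have S: "(\<Sum>j\<in>{- int n..int n}. truncated_abs j powr (- 1)) \<le> 3 * (1 + ln N)" .
  have "real (card F) \<le> 3 * N * (\<Sum>j\<in>{- int n..int n}. truncated_abs j powr (- 1)) ^ (CARD('d) - 1)"
  proof (rule card_le_by_fibers[OF F(1)])
    fix k assume k: "k \<in> F"
    show "k $ t \<in> {- int n..int n}" for t
    proof -
      have "\<bar>real_of_int (k $ t)\<bar> \<le> N"
        using prod_truncated_abs_ge[of k t] le[OF k] by (intro abs_le_of_truncated_abs_le) linarith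
      then have "\<bar>k $ t\<bar> \<le> int n" using n by linarith
      then show ?thesis by auto
    qed
    fix s
    have "truncated_abs (k $ s) * (\<Prod>t\<in>UNIV - {s}. truncated_abs (k $ t) powr 1) =
       (\<Prod>t\<in>UNIV. truncated_abs (k $ t))"
      by (subst prod.remove[of UNIV s]) (auto simp: less_imp_le[OF truncated_abs_pos])
    then show "truncated_abs (k $ s) * (\<Prod>t\<in>UNIV - {s}. truncated_abs (k $ t) powr 1) \<le> N"
      using le[OF k] by simp
  qed (use N in auto)
  also have "\<dots> \<le> 3 * N * (3 * (1 + ln N)) ^ (CARD('d) - 1)"
    using N S by (intro mult_left_mono power_mono sum_nonneg) auto
  finally show "real (card F) \<le> ?C * N * (1 + ln N) ^ (CARD('d) - 1)"
    by (simp only: power_mult_distrib mult_ac)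
qed

lemma card_le_sum_over_largest:
  fixes F :: "(int ^ 'd::finite) set"
  assumes "finite F" "\<And>s. real (card {k \<in> F. \<forall>t. truncated_abs (k $ t) \<le> truncated_abs (k $ s)}) \<le> b"
  shows "real (card F) \<le> real CARD('d) * b"
proof -
  let ?G = "\<lambda>s. {k \<in> F. \<forall>t. truncated_abs (k $ t) \<le> truncated_abs (k $ s)}"
  have "F \<subseteq> (\<Union>s\<in>UNIV. ?G s)" using exists_largest_component by blast
  then have "card F \<le> card (\<Union>s\<in>UNIV. ?G s)" using assms(1) by (intro card_mono) auto
  also have "\<dots> \<le> (\<Sum>s\<in>UNIV. card (?G s))" by (rule card_UN_le) simp
  finally have "real (card F) \<le> (\<Sum>s\<in>UNIV. real (card (?G s)))" by (simp flip: of_nat_sum)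
  also have "\<dots> \<le> (\<Sum>s\<in>(UNIV::'d set). b)" by (intro sum_mono assms(2))
  finally show ?thesis by simp
qed

lemma one_norm_le_largest:
  fixes k :: "int ^ 'd::finite"
  assumes "\<forall>t. truncated_abs (k $ t) \<le> truncated_abs (k $ s)"
  shows "max 1 (one_norm k) \<le> real CARD('d) * truncated_abs (k $ s)"
proof -
  have "one_norm k \<le> (\<Sum>t\<in>(UNIV::'d set). truncated_abs (k $ s))"
    unfolding one_norm_def using assms by (intro sum_mono abs_le_of_truncated_abs_le) auto
  moreover have "1 * 1 \<le> real CARD('d) * truncated_abs (k $ s)"
    by (intro mult_mono) (auto simp: truncated_abs_ge_1 Suc_le_eq)
  ultimately show ?thesis by simp
qed

text \<open>
  For a largest coordinate \<open>k $ s\<close>, the 1-norm is comparable with \<open>truncated_abs (k $ s)\<close>, so the condition on the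
  weight bounds \<open>truncated_abs (k $ s)\<close> times the product of the other coordinates to the power
  \<open>p = \<beta> / (\<alpha> + \<beta>)\<close>. As \<open>\<alpha> < 0\<close>, this exponent exceeds 1, and the sums that remain in the fibre count converge:
  no logarithm appears.
\<close>

lemma card_weight_le_neg:
  assumes "\<alpha> < 0" "\<alpha> > - \<beta>"
  shows "\<exists>C>0. \<forall>N\<ge>1. \<forall>F :: (int ^ 'd::finite) set. finite F \<longrightarrow> (\<forall>k\<in>F. weight \<alpha> \<beta> k \<le> N powr (\<alpha> + \<beta>)) \<longrightarrow>
    real (card F) \<le> C * N"
proof -
  define p where "p = \<beta> / (\<alpha> + \<beta>)"
  have p: "1 < p" and p\<alpha>\<beta>: "p * (\<alpha> + \<beta>) = \<beta>" using assms by (simp_all add: p_def)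
  obtain C2 where C2: "C2 > 0" "\<forall>X\<ge>1. \<forall>J. finite J \<longrightarrow> (\<forall>j\<in>J. X < \<bar>real_of_int j\<bar>) \<longrightarrow>
     (\<Sum>j\<in>J. truncated_abs j powr (- p)) \<le> C2 * X powr (1 - p)"
    using int_tail_sum_le[OF p] by blast
  define D where "D = real CARD('d) powr (- \<alpha> / (\<alpha> + \<beta>))"
  have D: "D > 0" by (simp add: D_def)
  define C where "C = real CARD('d) * (3 * D * (3 + C2) ^ (CARD('d) - 1))"
  have S: "(\<Sum>j\<in>A. truncated_abs j powr (- p)) \<le> 3 + C2" if "finite A" for A
  proof -
    let ?g = "\<lambda>j. truncated_abs j powr (- p)"
    have "sum ?g A \<le> sum ?g ({-1,0,1} \<union> (A - {-1,0,1}))"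
      using that by (intro sum_mono2) auto
    also have "\<dots> = sum ?g {-1,0,1} + sum ?g (A - {-1,0,1})"
      using that by (intro sum.union_disjoint) auto
    also have "sum ?g {-1,0,1} = 3" by (simp add: truncated_abs_def)
    also have "sum ?g (A - {-1,0,1}) \<le> C2 * 1 powr (1 - p)"
      using that by (intro C2(2)[rule_format]) auto
    finally show ?thesis by simp
  qed
  show ?thesis
  proof (intro exI[of _ C] conjI allI impI)
    show "0 < C" unfolding C_def using D C2 by (intro mult_pos_pos) auto
    fix N :: real and F :: "(int ^ 'd) set"
    assume N: "1 \<le> N" and F: "finite F" "\<forall>k\<in>F. weight \<alpha> \<beta> k \<le> N powr (\<alpha> + \<beta>)"
    have "real (card F) \<le> real CARD('d) * (3 * (D * N) * (3 + C2) ^ (CARD('d) - 1))"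
    proof (rule card_le_sum_over_largest[OF F(1)])
      fix s
      define G where "G = {k \<in> F. \<forall>t. truncated_abs (k $ t) \<le> truncated_abs (k $ s)}"
      define A where "A = (\<Union>k\<in>G. range (($) k))"
      have G: "finite G" using F by (auto simp: G_def)
      then have A: "finite A" by (auto simp: A_def)
      have "real (card G) \<le> 3 * (D * N) * (\<Sum>j\<in>A. truncated_abs j powr (- p)) ^ (CARD('d) - 1)"
      proof (rule card_le_by_fibers[OF G A])
        fix k assume k: "k \<in> G"
        show "k $ t \<in> A" for t using k by (auto simp: A_def)
        let ?x = "truncated_abs (k $ s)" and ?P = "\<Prod>t\<in>UNIV - {s}. truncated_abs (k $ t)"
        have P: "?P > 0" by (intro prod_pos) (auto simp: truncated_abs_pos)
        have x: "?x > 0" by (rule truncated_abs_pos)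
        have Pp: "(\<Prod>t\<in>UNIV - {s}. truncated_abs (k $ t) powr p) = ?P powr p"
          by (subst prod_powr_distrib) (auto simp: less_imp_le[OF truncated_abs_pos])
        have "(real CARD('d) * ?x) powr \<alpha> * (\<Prod>t\<in>UNIV. truncated_abs (k $ t)) powr \<beta> \<le> weight \<alpha> \<beta> k"
          unfolding weight_eq using one_norm_le_largest[of k s] k assms
          by (intro mult_right_mono powr_mono2') (auto simp: G_def)
        also have "\<dots> \<le> N powr (\<alpha> + \<beta>)" using F k by (auto simp: G_def)
        also have "(\<Prod>t\<in>UNIV. truncated_abs (k $ t)) = ?x * ?P"
          by (subst prod.remove[of UNIV s]) auto
        finally have "(real CARD('d) * ?x) powr \<alpha> * (?x * ?P) powr \<beta> \<le> N powr (\<alpha> + \<beta>)" .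
        also have "(real CARD('d) * ?x) powr \<alpha> * (?x * ?P) powr \<beta> = real CARD('d) powr \<alpha> * (?x * ?P powr p) powr (\<alpha> + \<beta>)"
        proof -
          have "(?P powr p) powr (\<alpha> + \<beta>) = ?P powr \<beta>" by (simp only: powr_powr p\<alpha>\<beta>)
          then have *: "(?x * ?P powr p) powr (\<alpha> + \<beta>) = ?x powr (\<alpha> + \<beta>) * ?P powr \<beta>"
            by (simp only: powr_mult)
          show ?thesis unfolding * by (simp only: powr_mult powr_add mult_ac)
        qed
        finally have "(?x * ?P powr p) powr (\<alpha> + \<beta>) \<le> real CARD('d) powr (- \<alpha>) * N powr (\<alpha> + \<beta>)"
          by (simp add: powr_minus field_simps)
        also have "real CARD('d) powr (- \<alpha>) * N powr (\<alpha> + \<beta>) = (D * N) powr (\<alpha> + \<beta>)"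
          using N D assms by (simp add: powr_mult D_def powr_powr)
        finally have "(?x * ?P powr p) powr (\<alpha> + \<beta>) \<le> (D * N) powr (\<alpha> + \<beta>)" .
        then have "?x * ?P powr p \<le> D * N"
        proof (rule contrapos_pp)
          assume "\<not> ?x * ?P powr p \<le> D * N"
          then have "(D * N) powr (\<alpha> + \<beta>) < (?x * ?P powr p) powr (\<alpha> + \<beta>)"
            using D N assms by (intro powr_less_mono2) auto
          then show "\<not> (?x * ?P powr p) powr (\<alpha> + \<beta>) \<le> (D * N) powr (\<alpha> + \<beta>)"
            by (simp only: not_le)
        qed
        then show "?x * (\<Prod>t\<in>UNIV - {s}. truncated_abs (k $ t) powr p) \<le> D * N" unfolding Pp .
      qed (use D N in auto)
      also have "\<dots> \<le> 3 * (D * N) * (3 + C2) ^ (CARD('d) - 1)"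
        using D N S[OF A] by (intro mult_left_mono power_mono sum_nonneg) auto
      finally show "real (card {k \<in> F. \<forall>t. truncated_abs (k $ t) \<le> truncated_abs (k $ s)})
        \<le> 3 * (D * N) * (3 + C2) ^ (CARD('d) - 1)" unfolding G_def .
    qed
    also have "\<dots> = C * N" by (simp add: C_def)
    finally show "real (card F) \<le> C * N" .
  qed
qed

text \<open>
  Let \<open>X = R powr (1 / (\<alpha> + d \<beta>))\<close>, so that the cube with side \<open>X\<close> has about \<open>X ^ d\<close> points, which is the claimed
  order. Outside this cube, let the coordinate \<open>s\<close> be the largest one. The indicator function of
  \<open>weight \<alpha> \<beta> k \<le> R\<close> is at most \<open>(R / weight \<alpha> \<beta> k) powr \<theta>\<close> for every \<open>\<theta> > 0\<close>. The other coordinates are bounded by the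
  largest one, of absolute value \<open>j\<close>, and summing over them gives the power \<open>j powr (- p)\<close> with \<open>p = \<theta> (\<alpha> + d \<beta>) - d + 1\<close>, provided
  that \<open>\<theta> \<beta> < 1\<close>. If also \<open>p > 1\<close>, the sum over \<open>j > X\<close> converges and is of the order \<open>X ^ d\<close> again. Both conditions
  can be met because \<open>\<alpha> > 0\<close>.
\<close>

lemma card_weight_le_pos:
  assumes "\<alpha> > 0" "\<beta> \<ge> 0"
  shows "\<exists>C>0. \<forall>R\<ge>1. \<forall>F :: (int ^ 'd::finite) set. finite F \<longrightarrow> (\<forall>k\<in>F. weight \<alpha> \<beta> k \<le> R) \<longrightarrow>
    real (card F) \<le> C * R powr (1 / (\<alpha> / real CARD('d) + \<beta>))"
proof -
  define d where "d = real CARD('d)"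
  have d: "1 \<le> d" by (simp add: d_def Suc_le_eq)
  have ad: "0 < \<alpha> + d * \<beta>" "0 < \<alpha> / 2 + d * \<beta>" using assms d by (auto intro: add_pos_nonneg)
  \<comment> \<open>This lies strictly between \<open>d / (\<alpha> + d \<beta>)\<close>, which is needed for \<open>p > 1\<close>, and \<open>1 / \<beta>\<close>,
      which is needed for \<open>\<theta> \<beta> < 1\<close>; for \<open>\<beta> = 0\<close> the second condition is void.\<close>
  define \<theta> where "\<theta> = d / (\<alpha> / 2 + d * \<beta>)"
  define \<gamma> where "\<gamma> = \<theta> * \<beta>"
  define p where "p = \<theta> * (\<alpha> + d * \<beta>) - d + 1"
  have \<theta>: "0 < \<theta>" using d ad by (simp add: \<theta>_def)
  have \<gamma>: "0 \<le> \<gamma>" "\<gamma> < 1" using assms \<theta> ad by (auto simp: \<gamma>_def \<theta>_def field_simps)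
  have "\<theta> * (\<alpha> / 2 + d * \<beta>) = d" using ad by (simp add: \<theta>_def)
  moreover have "\<theta> * (\<alpha> / 2 + d * \<beta>) < \<theta> * (\<alpha> + d * \<beta>)" using assms \<theta> by (intro mult_strict_left_mono) auto
  ultimately have p: "1 < p" by (simp add: p_def)
  obtain C1 where C1: "C1 > 0" "\<And>j::int. (\<Sum>i\<in>{- \<bar>j\<bar>..\<bar>j\<bar>}. truncated_abs i powr (- \<gamma>)) \<le> C1 * truncated_abs j powr (1 - \<gamma>)"
    using int_head_sum_le[OF \<gamma>] by blast
  obtain C2 where C2: "C2 > 0" "\<And>X J. X \<ge> 1 \<Longrightarrow> finite J \<Longrightarrow> (\<And>j. j\<in>J \<Longrightarrow> X < \<bar>real_of_int j\<bar>) \<Longrightarrow>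
     (\<Sum>j\<in>J. truncated_abs j powr (- p)) \<le> C2 * X powr (1 - p)"
    using int_tail_sum_le[OF p] by metis
  define b where "b = 3 ^ CARD('d) + C1 ^ (CARD('d) - 1) * C2"
  have b: "b > 0" unfolding b_def using C1 C2 by (intro add_pos_pos) auto
  show ?thesis
  proof (intro exI[of _ "d * b"] conjI allI impI)
    show "0 < d * b" using b d by auto
    fix R :: real and F :: "(int ^ 'd) set"
    assume R: "1 \<le> R" and F: "finite F" "\<forall>k\<in>F. weight \<alpha> \<beta> k \<le> R"
    define X where "X = R powr (1 / (\<alpha> + d * \<beta>))"
    have X: "1 \<le> X" using R ad by (simp add: X_def ge_one_powr_ge_zero)
    have "real (card F) \<le> real CARD('d) * (b * X powr d)"
    proof (rule card_le_sum_over_largest[OF F(1)])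
      fix s
      define G where "G = {k \<in> F. \<forall>t. truncated_abs (k $ t) \<le> truncated_abs (k $ s)}"
      define G0 where "G0 = {k \<in> G. \<bar>real_of_int (k $ s)\<bar> \<le> X}"
      define G1 where "G1 = {k \<in> G. X < \<bar>real_of_int (k $ s)\<bar>}"
      have G01: "finite G0" "finite G1" "G = G0 \<union> G1" using F by (auto simp: G_def G0_def G1_def)
      have "real (card G0) \<le> 3 ^ CARD('d) * X powr d"
      proof -
        let ?I = "{- \<lfloor>X\<rfloor>..\<lfloor>X\<rfloor>}"
        have "G0 \<subseteq> {k. \<forall>t. k $ t \<in> ?I}"
        proof
          fix k assume k: "k \<in> G0"
          have "k $ t \<in> ?I" for t
          proof -
            have "truncated_abs (k $ t) \<le> truncated_abs (k $ s)" using k by (auto simp: G0_def G_def)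
            also have "\<dots> \<le> X" using k X by (auto simp: G0_def truncated_abs_def)
            finally show ?thesis using abs_le_of_truncated_abs_le[of "k $ t" X]
              by (simp add: le_floor_iff) linarith
          qed
          then show "k \<in> {k. \<forall>t. k $ t \<in> ?I}" by auto
        qed
        then have "card G0 \<le> card {k :: int ^ 'd. \<forall>t. k $ t \<in> ?I}"
          by (intro card_mono finite_vec_box) auto
        also have "real \<dots> = (\<Sum>k\<in>{k :: int ^ 'd. \<forall>t. k $ t \<in> ?I}. \<Prod>t\<in>(UNIV::'d set). 1)" by simp
        also have "\<dots> = (\<Prod>t\<in>(UNIV::'d set). \<Sum>j\<in>?I. 1)" by (rule sum_vec_box) auto
        also have "\<dots> = real (card ?I) ^ CARD('d)" by simp
        also have "\<dots> \<le> (3 * X) ^ CARD('d)"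
          using X by (intro power_mono) (simp_all, linarith)
        also have "\<dots> = 3 ^ CARD('d) * X powr d"
          using X by (simp add: power_mult_distrib d_def powr_realpow)
        finally show ?thesis by simp
      qed
      moreover have "real (card G1) \<le> C1 ^ (CARD('d) - 1) * C2 * X powr d"
      proof -
        define w where "w k = (\<Prod>t\<in>UNIV. truncated_abs (k $ t) powr (- \<gamma>))" for k :: "int ^ 'd"
        define c where "c j = R powr \<theta> * truncated_abs j powr (- (\<theta> * \<alpha>))" for j
        have w0: "0 \<le> w k" for k unfolding w_def by (intro prod_nonneg) auto
        have c0: "0 \<le> c j" for j unfolding c_def by simp
        \<comment> \<open>Rankin's trick: each counted point contributes at least 1 to the weighted sum.\<close>
        have one: "1 \<le> c (k $ s) * w k" if "k \<in> G1" for k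
        proof -
          let ?P = "\<Prod>t\<in>UNIV. truncated_abs (k $ t)"
          have P: "0 < ?P" by (intro prod_pos) (auto simp: truncated_abs_pos)
          have x: "0 < truncated_abs (k $ s)" by (rule truncated_abs_pos)
          have "truncated_abs (k $ s) powr \<alpha> * ?P powr \<beta> \<le> weight \<alpha> \<beta> k"
            unfolding weight_eq using assms truncated_abs_le_one_norm[of k s] x
            by (intro mult_right_mono powr_mono2) auto
          also have "\<dots> \<le> R" using F that by (auto simp: G1_def G_def)
          finally have "(truncated_abs (k $ s) powr \<alpha> * ?P powr \<beta>) powr \<theta> \<le> R powr \<theta>"
            using \<theta> by (intro powr_mono2) auto
          then have "truncated_abs (k $ s) powr (\<theta> * \<alpha>) * ?P powr \<gamma> \<le> R powr \<theta>"
            using x P by (simp add: powr_mult powr_powr \<gamma>_def mult.commute)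
          moreover have "0 < truncated_abs (k $ s) powr (\<theta> * \<alpha>) * ?P powr \<gamma>"
            using x P by (metis mult_pos_pos powr_gt_zero less_irrefl)
          ultimately have "1 \<le> R powr \<theta> / (truncated_abs (k $ s) powr (\<theta> * \<alpha>) * ?P powr \<gamma>)"
            by (simp only: le_divide_eq_1_pos)
          then have "1 \<le> R powr \<theta> * (inverse (truncated_abs (k $ s) powr (\<theta> * \<alpha>)) * inverse (?P powr \<gamma>))"
            by (simp only: divide_inverse inverse_mult_distrib)
          also have "inverse (?P powr \<gamma>) = w k"
            unfolding w_def powr_minus[symmetric]
            by (subst prod_powr_distrib) (auto simp: less_imp_le[OF truncated_abs_pos])
          finally show ?thesis unfolding c_def powr_minus by simp
        qed
        let ?J = "(\<lambda>k. k $ s) ` G1"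
        define Q where "Q j = {k :: int ^ 'd. \<forall>t. k $ t \<in> (if t = s then {j} else {- \<bar>j\<bar>..\<bar>j\<bar>})}" for j
        have inner: "(\<Sum>k\<in>{k \<in> G1. k $ s = j}. c (k $ s) * w k) \<le>
            R powr \<theta> * C1 ^ (CARD('d) - 1) * truncated_abs j powr (- p)" if "j \<in> ?J" for j
        proof -
          have x: "0 < truncated_abs j" by (rule truncated_abs_pos)
          have "(\<Sum>k\<in>{k \<in> G1. k $ s = j}. c (k $ s) * w k) = c j * (\<Sum>k\<in>{k \<in> G1. k $ s = j}. w k)"
            by (simp add: sum_distrib_left)
          also have "(\<Sum>k\<in>{k \<in> G1. k $ s = j}. w k) \<le> (\<Sum>k\<in>Q j. w k)"
          proof (rule sum_mono2)
            show "finite (Q j)" unfolding Q_def by (rule finite_vec_box) auto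
            show "{k \<in> G1. k $ s = j} \<subseteq> Q j"
            proof
              fix k assume k: "k \<in> {k \<in> G1. k $ s = j}"
              have "k $ t \<in> {- \<bar>j\<bar>..\<bar>j\<bar>}" for t
              proof -
                have "truncated_abs (k $ t) \<le> truncated_abs j" using k by (auto simp: G1_def G_def)
                also have "truncated_abs j = \<bar>real_of_int j\<bar>" using k X by (auto simp: G1_def truncated_abs_def)
                finally show ?thesis using abs_le_of_truncated_abs_le[of "k $ t" "\<bar>real_of_int j\<bar>"] by auto
              qed
              then show "k \<in> Q j" using k by (auto simp: Q_def)
            qed
          qed (use w0 in auto)
          also have "(\<Sum>k\<in>Q j. w k) = (\<Prod>t\<in>(UNIV::'d set). \<Sum>i\<in>(if t = s then {j} else {- \<bar>j\<bar>..\<bar>j\<bar>}). truncated_abs i powr (- \<gamma>))"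
            unfolding Q_def w_def by (rule sum_vec_box) auto
          also have "\<dots> = (\<Prod>t\<in>(UNIV::'d set). if t = s then truncated_abs j powr (- \<gamma>) else \<Sum>i\<in>{- \<bar>j\<bar>..\<bar>j\<bar>}. truncated_abs i powr (- \<gamma>))"
            by (rule prod.cong) auto
          also have "\<dots> = truncated_abs j powr (- \<gamma>) * (\<Sum>i\<in>{- \<bar>j\<bar>..\<bar>j\<bar>}. truncated_abs i powr (- \<gamma>)) ^ (CARD('d) - 1)"
            by (rule prod_except_one)
          also have "\<dots> \<le> truncated_abs j powr (- \<gamma>) * (C1 * truncated_abs j powr (1 - \<gamma>)) ^ (CARD('d) - 1)"
            by (intro mult_left_mono power_mono C1 sum_nonneg) auto
          also have "\<dots> = C1 ^ (CARD('d) - 1) * truncated_abs j powr (- \<gamma> + (1 - \<gamma>) * (d - 1))"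
          proof -
            have "(truncated_abs j powr (1 - \<gamma>)) ^ (CARD('d) - 1) = truncated_abs j powr ((1 - \<gamma>) * (d - 1))"
              using x d by (simp add: d_def powr_powr of_nat_diff flip: powr_realpow)
            then show ?thesis by (simp only: power_mult_distrib powr_add mult_ac)
          qed
          finally have "(\<Sum>k\<in>{k \<in> G1. k $ s = j}. c (k $ s) * w k) \<le>
              c j * (C1 ^ (CARD('d) - 1) * truncated_abs j powr (- \<gamma> + (1 - \<gamma>) * (d - 1)))"
            using c0 by (simp add: mult_left_mono)
          also have "\<dots> = R powr \<theta> * C1 ^ (CARD('d) - 1) * truncated_abs j powr (- (\<theta> * \<alpha>) + (- \<gamma> + (1 - \<gamma>) * (d - 1)))"
            unfolding c_def powr_add[of _ "- (\<theta> * \<alpha>)"] by simp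
          also have "- (\<theta> * \<alpha>) + (- \<gamma> + (1 - \<gamma>) * (d - 1)) = - p"
            by (simp add: p_def \<gamma>_def algebra_simps)
          finally show ?thesis .
        qed
        have "real (card G1) = (\<Sum>k\<in>G1. 1)" by simp
        also have "\<dots> \<le> (\<Sum>k\<in>G1. c (k $ s) * w k)" by (intro sum_mono one)
        also have "\<dots> = (\<Sum>j\<in>?J. \<Sum>k\<in>{k \<in> G1. k $ s = j}. c (k $ s) * w k)"
          by (rule sum.image_gen) (rule G01)
        also have "\<dots> \<le> (\<Sum>j\<in>?J. R powr \<theta> * C1 ^ (CARD('d) - 1) * truncated_abs j powr (- p))"
          by (intro sum_mono inner)
        also have "\<dots> = R powr \<theta> * C1 ^ (CARD('d) - 1) * (\<Sum>j\<in>?J. truncated_abs j powr (- p))"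
          by (simp add: sum_distrib_left)
        also have "\<dots> \<le> R powr \<theta> * C1 ^ (CARD('d) - 1) * (C2 * X powr (1 - p))"
        proof (rule mult_left_mono)
          show "(\<Sum>j\<in>?J. truncated_abs j powr (- p)) \<le> C2 * X powr (1 - p)"
            by (rule C2(2)[OF X]) (use G01(2) in \<open>auto simp: G1_def\<close>)
          show "0 \<le> R powr \<theta> * C1 ^ (CARD('d) - 1)" using C1(1) by simp
        qed
        also have "R powr \<theta> * C1 ^ (CARD('d) - 1) * (C2 * X powr (1 - p)) = C1 ^ (CARD('d) - 1) * C2 * (R powr \<theta> * X powr (1 - p))"
          by simp
        also have "R powr \<theta> * X powr (1 - p) = X powr d"
        proof -
          have "R powr \<theta> = X powr (\<theta> * (\<alpha> + d * \<beta>))"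
            using R ad by (simp add: X_def powr_powr)
          then show ?thesis by (simp add: p_def flip: powr_add)
        qed
        finally show ?thesis .
      qed
      moreover have "real (card G) \<le> real (card G0) + real (card G1)"
        using card_Un_le[of G0 G1] G01(3) by simp
      ultimately have "real (card G) \<le> b * X powr d"
        by (simp add: b_def distrib_right)
      then show "real (card {k \<in> F. \<forall>t. truncated_abs (k $ t) \<le> truncated_abs (k $ s)}) \<le> b * X powr d"
        unfolding G_def .
    qed
    also have "X powr d = R powr (1 / (\<alpha> / d + \<beta>))"
    proof -
      have "\<alpha> / d + \<beta> = (\<alpha> + d * \<beta>) / d" using d by (simp add: add_divide_distrib)
      then show ?thesis by (simp add: X_def powr_powr)
    qed
    finally show "real (card F) \<le> d * b * R powr (1 / (\<alpha> / real CARD('d) + \<beta>))"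
      by (simp add: d_def)
  qed
qed

section \<open>Fourier series of continuous functions on the torus\<close>

definition torus_character :: "int ^ 'd \<Rightarrow> real ^ 'd::finite \<Rightarrow> complex"
  where "torus_character k x = exp (2 * complex_of_real pi * \<i> * complex_of_real (real_vec k \<bullet> x))"

lemma real_vec_0 [simp]: "real_vec 0 = 0"
  by (simp add: real_vec_def vec_eq_iff)

lemma real_vec_add: "real_vec (k + l) = real_vec k + real_vec l"
  by (simp add: real_vec_def vec_eq_iff)

lemma real_vec_minus: "real_vec (- k) = - real_vec k"
  by (simp add: real_vec_def vec_eq_iff)

lemma torus_character_0 [simp]: "torus_character 0 x = 1"
  by (simp add: torus_character_def)

lemma torus_character_add: "torus_character (k + l) x = torus_character k x * torus_character l x"
  by (simp add: torus_character_def real_vec_add inner_add_left ring_distribs exp_add)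

lemma torus_character_minus_left: "torus_character (- k) x =
    exp (- (2 * complex_of_real pi * \<i> * complex_of_real (real_vec k \<bullet> x)))"
  by (simp add: torus_character_def real_vec_minus)

lemma norm_torus_character [simp]: "norm (torus_character k x) = 1"
  by (simp add: torus_character_def)

lemma continuous_on_torus_character [continuous_intros]: "continuous_on S (torus_character k)"
  unfolding torus_character_def by (intro continuous_intros)

lemma inner_real_vec: "real_vec k \<bullet> real_vec h = of_int (int_dot k h)"
  by (simp add: inner_vec_def real_vec_def int_dot_def)

lemma exp_2pi_of_int: "exp (2 * complex_of_real pi * \<i> * of_int n) = 1"
  using exp_integer_2pi[of "of_int n"] by (simp add: mult_ac)

lemma torus_character_real_vec: "torus_character k (real_vec h) = 1"
  unfolding torus_character_def inner_real_vec of_real_of_int_eq by (rule exp_2pi_of_int)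

lemma torus_character_plus: "torus_character k (x + y) = torus_character k x * torus_character k y"
  by (simp add: torus_character_def inner_add_right ring_distribs exp_add)

lemma periodic_torus_character: "periodic (torus_character k)"
  by (simp add: periodic_def torus_character_plus torus_character_real_vec)

lemma fourier_coeff_eq:
  "fourier_coeff f k = integral\<^sup>L (lebesgue_on unit_cube) (\<lambda>x. f x * torus_character (- k) x)"
  by (simp add: fourier_coeff_def torus_character_minus_left)

lemma unit_cube_iff: "x \<in> unit_cube \<longleftrightarrow> (\<forall>b\<in>Basis. x \<bullet> b \<in> {0..<1})"
  by (auto simp: unit_cube_def Basis_vec_def inner_axis)

lemma unit_cube_subset_cbox: "unit_cube \<subseteq> cbox 0 One"
proof
  fix x :: "real ^ 'a" assume "x \<in> unit_cube"
  then have "\<forall>b\<in>Basis. 0 \<le> x \<bullet> b \<and> x \<bullet> b < 1" by (simp add: unit_cube_iff)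
  then show "x \<in> cbox 0 One" by (simp add: mem_box less_imp_le)
qed

lemma unit_cube_borel [measurable]: "unit_cube \<in> sets borel"
proof -
  have "unit_cube = (\<Inter>b\<in>Basis. {x :: real ^ 'a. x \<bullet> b \<in> {0..<1}})"
    by (auto simp: unit_cube_iff)
  also have "\<dots> \<in> sets borel"
  proof (rule sets.finite_INT)
    fix b :: "real ^ 'a"
    have "(\<lambda>x. x \<bullet> b) -` {0..<1} \<inter> space borel \<in> sets borel"
      by (rule measurable_sets[where A = borel]) measurable
    then show "{x. x \<bullet> b \<in> {0..<1}} \<in> sets borel" by (simp add: vimage_def)
  qed auto
  finally show ?thesis .
qed

lemma unit_cube_lebesgue [measurable]: "unit_cube \<in> sets lebesgue"
  using unit_cube_borel by simp

lemma integral_unit_cube_eq: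
  fixes f :: "real ^ 'd::finite \<Rightarrow> complex"
  assumes "f \<in> borel_measurable borel"
  shows "integral\<^sup>L (lebesgue_on unit_cube) f = integral\<^sup>L lborel (\<lambda>x. indicator unit_cube x *\<^sub>R f x)"
proof -
  have "(\<lambda>x. indicator unit_cube x *\<^sub>R f x) \<in> borel_measurable lborel"
    using assms by measurable
  then show ?thesis
    by (subst integral_restrict_space) (simp_all add: integral_completion unit_cube_lebesgue)
qed

lemma integral_lborel_prod:
  fixes f :: "'a::euclidean_space \<Rightarrow> real \<Rightarrow> complex"
  assumes "\<And>b. b \<in> Basis \<Longrightarrow> integrable lborel (f b)"
  shows "(\<integral>x. (\<Prod>b\<in>Basis. f b (x \<bullet> b)) \<partial>(lborel :: 'a measure)) = (\<Prod>b\<in>Basis. (\<integral>t. f b t \<partial>lborel))"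
proof -
  interpret product_sigma_finite "\<lambda>b::'a. lborel :: real measure" ..
  have [measurable]: "f b \<in> borel_measurable borel" if "b \<in> Basis" for b
    using borel_measurable_integrable[OF assms[OF that]] by simp
  have "(\<integral>x. (\<Prod>b\<in>Basis. f b (x \<bullet> b)) \<partial>(lborel :: 'a measure)) =
        (\<integral>x. (\<Prod>b\<in>Basis. f b (x \<bullet> b)) \<partial>distr (\<Pi>\<^sub>M b\<in>Basis. lborel) borel (\<lambda>f. \<Sum>b\<in>Basis. f b *\<^sub>R b))"
    by (subst lborel_eq) simp
  also have "\<dots> = (\<integral>g. (\<Prod>b\<in>Basis. f b ((\<Sum>c\<in>Basis. g c *\<^sub>R c) \<bullet> b)) \<partial>(\<Pi>\<^sub>M b\<in>(Basis :: 'a set). lborel))"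
    by (subst integral_distr) simp_all
  also have "\<dots> = (\<integral>g. (\<Prod>b\<in>Basis. f b (g b)) \<partial>(\<Pi>\<^sub>M b\<in>(Basis :: 'a set). lborel))"
    by (intro Bochner_Integration.integral_cong refl prod.cong) simp_all
  also have "\<dots> = (\<Prod>b\<in>Basis. (\<integral>t. f b t \<partial>lborel))"
    by (rule product_integral_prod) (use assms in auto)
  finally show ?thesis .
qed

lemma has_bochner_integral_exp_period:
  "has_bochner_integral lborel (\<lambda>t. indicator {0..<1} t *\<^sub>R exp (2 * complex_of_real pi * \<i> * of_int n * complex_of_real t))
     (if n = 0 then 1 else 0)"
proof -
  let ?c = "2 * complex_of_real pi * \<i> * of_int n"
  let ?F = "\<lambda>t. if n = 0 then complex_of_real t else exp (?c * complex_of_real t) / ?c"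
  have "has_bochner_integral lborel (\<lambda>t. indicator {0..1} t *\<^sub>R exp (?c * complex_of_real t)) (?F 1 - ?F 0)"
  proof (rule has_bochner_integral_FTC_Icc)
    fix t :: real assume "0 \<le> t" "t \<le> 1"
    show "(?F has_vector_derivative exp (?c * complex_of_real t)) (at t within {0..1})"
    proof (cases "n = 0")
      case False
      have "((\<lambda>t. exp (?c * complex_of_real t) / ?c) has_vector_derivative exp (?c * complex_of_real t)) (at t within {0..1})"
        by (rule has_vector_derivative_real_field) (use False in \<open>auto intro!: derivative_eq_intros\<close>)
      then show ?thesis using False by simp
    qed (auto intro!: derivative_eq_intros)
  qed (auto intro!: continuous_intros)
  moreover have "?F 1 - ?F 0 = (if n = 0 then 1 else 0)"
    using exp_2pi_of_int[of n] by simp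
  moreover have "has_bochner_integral lborel (\<lambda>t. indicator {0..<1} t *\<^sub>R exp (?c * complex_of_real t)) z \<longleftrightarrow>
      has_bochner_integral lborel (\<lambda>t. indicator {0..1} t *\<^sub>R exp (?c * complex_of_real t)) z" for z
  proof (rule has_bochner_integral_cong_AE)
    show "AE t in lborel. indicator {0..<1} t *\<^sub>R exp (?c * complex_of_real t) = indicator {0..1} t *\<^sub>R exp (?c * complex_of_real t)"
      using AE_lborel_singleton[of "1::real"] by eventually_elim (auto simp: indicator_def)
  qed measurable
  ultimately show ?thesis by simp
qed

text \<open>
  The character is a product of functions of one coordinate each, so its integral is the product of
  the one-dimensional integrals over a period.
\<close>

lemma integral_torus_character:
  fixes k :: "int ^ 'd::finite"
  shows "integral\<^sup>L (lebesgue_on unit_cube) (torus_character k) = (if k = 0 then 1 else 0)"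
proof -
  define f :: "real ^ 'd \<Rightarrow> real \<Rightarrow> complex" where
    "f b t = indicator {0..<1} t *\<^sub>R exp (2 * complex_of_real pi * \<i> * complex_of_real (real_vec k \<bullet> b) * complex_of_real t)" for b t
  have comp: "\<exists>n. real_vec k \<bullet> b = of_int n" if "b \<in> Basis" for b :: "real ^ 'd"
  proof -
    obtain s where "b = axis s 1" using \<open>b \<in> Basis\<close> unfolding Basis_vec_def by auto
    then have "real_vec k \<bullet> b = of_int (k $ s)" by (simp add: inner_axis real_vec_def)
    then show ?thesis by blast
  qed
  have f: "has_bochner_integral lborel (f b) (if real_vec k \<bullet> b = 0 then 1 else 0)" if b: "b \<in> Basis" for b
  proof -
    obtain n where n: "real_vec k \<bullet> b = of_int n" using comp[OF b] by auto
    show ?thesis using has_bochner_integral_exp_period[of n] unfolding f_def n by simp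
  qed
  have prod: "indicator unit_cube x *\<^sub>R torus_character k x = (\<Prod>b\<in>Basis. f b (x \<bullet> b))" for x
  proof (cases "x \<in> unit_cube")
    case True
    then have "(\<Prod>b\<in>Basis. f b (x \<bullet> b)) =
      (\<Prod>b\<in>Basis. exp (2 * complex_of_real pi * \<i> * complex_of_real (real_vec k \<bullet> b) * complex_of_real (x \<bullet> b)))"
      by (intro prod.cong refl) (simp add: f_def unit_cube_iff)
    also have "\<dots> = exp (\<Sum>b\<in>Basis. 2 * complex_of_real pi * \<i> * complex_of_real (real_vec k \<bullet> b) * complex_of_real (x \<bullet> b))"
      by (rule exp_sum[symmetric]) simp
    also have "\<dots> = torus_character k x"
      unfolding torus_character_def
      by (subst euclidean_inner[of "real_vec k"]) (simp only: of_real_sum of_real_mult sum_distrib_left mult.assoc)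
    finally show ?thesis using True by simp
  next
    case False
    then obtain b :: "real ^ 'd" where b: "b \<in> Basis" "x \<bullet> b \<notin> {0..<1}" unfolding unit_cube_iff by blast
    then have "f b (x \<bullet> b) = 0" by (simp add: f_def indicator_def del: atLeastLessThan_iff)
    then have "(\<Prod>b\<in>Basis. f b (x \<bullet> b)) = 0" using b(1) by (intro prod_zero) auto
    then show ?thesis using False by simp
  qed
  have "integral\<^sup>L (lebesgue_on unit_cube) (torus_character k) = (\<integral>x. (\<Prod>b\<in>Basis. f b (x \<bullet> b)) \<partial>lborel)"
    unfolding prod[symmetric]
    by (rule integral_unit_cube_eq) (intro borel_measurable_continuous_onI continuous_on_torus_character)
  also have "\<dots> = (\<Prod>b\<in>Basis. (\<integral>t. f b t \<partial>lborel))"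
    by (rule integral_lborel_prod) (use f has_bochner_integral_iff in blast)
  also have "\<dots> = (\<Prod>b\<in>(Basis :: (real ^ 'd) set). if real_vec k \<bullet> b = 0 then 1 else 0)"
    by (rule prod.cong[OF refl]) (rule has_bochner_integral_integral_eq[OF f])
  also have "\<dots> = (if k = 0 then 1 else 0)"
  proof (cases "k = 0")
    case False
    then obtain s where "k $ s \<noteq> 0" by (auto simp: vec_eq_iff)
    then have "real_vec k \<bullet> axis s 1 \<noteq> 0" "axis s 1 \<in> (Basis :: (real ^ 'd) set)"
      by (auto simp: inner_axis real_vec_def)
    then have "(\<Prod>b\<in>(Basis :: (real ^ 'd) set). if real_vec k \<bullet> b = 0 then 1 else (0::complex)) = 0"
      by (intro prod_zero) auto
    then show ?thesis using False by simp
  qed simp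
  finally show ?thesis .
qed

lemma measure_unit_cube:
  "finite_measure (lebesgue_on (unit_cube :: (real ^ 'd::finite) set))"
  "measure (lebesgue_on (unit_cube :: (real ^ 'd::finite) set)) unit_cube = 1"
proof -
  have "(unit_cube :: (real ^ 'd) set) \<subseteq> cbox 0 One"
    by (rule unit_cube_subset_cbox)
  then have "emeasure lebesgue (unit_cube :: (real ^ 'd) set) \<le> emeasure lebesgue (cbox 0 (One :: real ^ 'd))"
    by (intro emeasure_mono) auto
  also have "\<dots> < \<infinity>" by (simp add: emeasure_lborel_cbox_eq)
  finally show fin: "finite_measure (lebesgue_on (unit_cube :: (real ^ 'd::finite) set))"
    by (intro finite_measureI) (simp add: emeasure_restrict_space)
  interpret finite_measure "lebesgue_on (unit_cube :: (real ^ 'd::finite) set)" by (rule fin)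
  have "torus_character (0 :: int ^ 'd) = (\<lambda>x. 1)" by auto
  then have "integral\<^sup>L (lebesgue_on (unit_cube :: (real ^ 'd) set)) (\<lambda>x. 1 :: complex) = 1"
    using integral_torus_character[of "0 :: int ^ 'd"] by (simp only: if_True simp_thms)
  then show "measure (lebesgue_on (unit_cube :: (real ^ 'd::finite) set)) unit_cube = 1"
    by (simp add: scaleR_conv_of_real)
qed

lemma integrable_unit_cube:
  fixes f :: "real ^ 'd::finite \<Rightarrow> 'b::{banach, second_countable_topology}"
  assumes "continuous_on UNIV f"
  shows "integrable (lebesgue_on unit_cube) f"
proof -
  interpret finite_measure "lebesgue_on (unit_cube :: (real ^ 'd::finite) set)" by (rule measure_unit_cube)
  have "bounded (f ` cbox 0 One)"
    by (intro compact_imp_bounded compact_continuous_image continuous_on_subset[OF assms]) auto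
  then obtain B where B: "\<And>x. x \<in> cbox 0 One \<Longrightarrow> norm (f x) \<le> B" by (auto simp: bounded_iff)
  show ?thesis
  proof (rule integrable_const_bound)
    show "AE x in lebesgue_on unit_cube. norm (f x) \<le> B"
      by (rule AE_I2, rule B) (use unit_cube_subset_cbox in auto)
    show "f \<in> borel_measurable (lebesgue_on unit_cube)"
      by (rule continuous_imp_measurable_on_sets_lebesgue) (auto intro: continuous_on_subset[OF assms])
  qed
qed

lemma integrable_times_character:
  "continuous_on UNIV f \<Longrightarrow> integrable (lebesgue_on unit_cube) (\<lambda>x. f x * torus_character k x)"
  by (rule integrable_unit_cube) (rule continuous_on_mult, assumption, rule continuous_on_torus_character)

lemma fourier_coeff_add:
  assumes "continuous_on UNIV f" "continuous_on UNIV g"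
  shows "fourier_coeff (\<lambda>x. f x + g x) k = fourier_coeff f k + fourier_coeff g k"
  unfolding fourier_coeff_eq distrib_right
  by (rule Bochner_Integration.integral_add) (rule integrable_times_character, rule assms)+

lemma fourier_coeff_diff:
  assumes "continuous_on UNIV f" "continuous_on UNIV g"
  shows "fourier_coeff (\<lambda>x. f x - g x) k = fourier_coeff f k - fourier_coeff g k"
  unfolding fourier_coeff_eq left_diff_distrib
  by (rule Bochner_Integration.integral_diff) (rule integrable_times_character, rule assms)+

lemma fourier_coeff_torus_character:
  "fourier_coeff (torus_character h) k = (if h = k then 1 else 0)"
  unfolding fourier_coeff_eq torus_character_add[symmetric]
  using integral_torus_character[of "h + - k"] by simp

lemma fourier_coeff_trig_polynomial:
  assumes "finite F"
  shows "fourier_coeff (\<lambda>x. \<Sum>h\<in>F. c h * torus_character h x) k = (if k \<in> F then c k else 0)"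
  using assms
proof (induction F rule: finite_induct)
  case empty
  show ?case by (simp add: fourier_coeff_eq)
next
  case (insert h F)
  have *: "fourier_coeff (\<lambda>x. c h * torus_character h x) k = c h * fourier_coeff (torus_character h) k"
    by (simp add: fourier_coeff_eq mult.assoc)
  show ?case
  proof -
    have "fourier_coeff (\<lambda>x. \<Sum>h\<in>insert h F. c h * torus_character h x) k =
        fourier_coeff (\<lambda>x. c h * torus_character h x + (\<Sum>h\<in>F. c h * torus_character h x)) k"
      using insert.hyps by simp
    also have "\<dots> = fourier_coeff (\<lambda>x. c h * torus_character h x) k + fourier_coeff (\<lambda>x. \<Sum>h\<in>F. c h * torus_character h x) k"
      by (rule fourier_coeff_add) (intro continuous_on_sum continuous_on_mult continuous_on_const continuous_on_torus_character)+
    finally show ?thesis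
      using insert.hyps insert.IH * by (auto simp: fourier_coeff_torus_character)
  qed
qed

lemma norm_fourier_coeff_le:
  fixes f :: "real ^ 'd::finite \<Rightarrow> complex"
  assumes "continuous_on UNIV f" "\<And>x. norm (f x) \<le> B"
  shows "norm (fourier_coeff f k) \<le> B"
proof -
  interpret finite_measure "lebesgue_on (unit_cube :: (real ^ 'd::finite) set)" by (rule measure_unit_cube)
  have "norm (fourier_coeff f k) \<le> integral\<^sup>L (lebesgue_on unit_cube) (\<lambda>x. norm (f x * torus_character (- k) x))"
    unfolding fourier_coeff_eq by (rule integral_norm_bound)
  also have "\<dots> \<le> integral\<^sup>L (lebesgue_on (unit_cube :: (real ^ 'd) set)) (\<lambda>x. B)"
    by (intro integral_mono integrable_unit_cube continuous_intros assms) (simp add: norm_mult assms)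
  finally show ?thesis by (simp add: measure_unit_cube)
qed

text \<open>
  If \<open>r y\<close> were positive, the powers \<open>q ^ n\<close> would concentrate near \<open>y\<close>: on a neighbourhood \<open>V\<close> of \<open>y\<close>
  they are at least \<open>\<sigma> ^ n\<close>, while away from \<open>y\<close> they are at most \<open>\<rho> ^ n\<close> with \<open>\<rho> < \<sigma>\<close>. For large \<open>n\<close> the positive
  contribution of \<open>V\<close> outweighs the rest and the integral cannot vanish.
\<close>

lemma nonpos_at_peak:
  fixes r q :: "real ^ 'd::finite \<Rightarrow> real"
  assumes r: "continuous_on UNIV r" and q: "continuous_on UNIV q"
    and q01: "\<And>x. 0 \<le> q x" "\<And>x. q x \<le> 1" and qy: "q y = 1"
    and peak: "\<And>x. x \<in> cbox 0 One \<Longrightarrow> x \<noteq> y \<Longrightarrow> q x < 1"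
    and y: "y \<in> box 0 One"
    and zero: "\<And>n. integral\<^sup>L (lebesgue_on unit_cube) (\<lambda>x. r x * q x ^ n) = 0"
  shows "r y \<le> 0"
proof (rule ccontr)
  assume "\<not> r y \<le> 0"
  then have ry: "0 < r y" by simp
  interpret finite_measure "lebesgue_on (unit_cube :: (real ^ 'd::finite) set)" by (rule measure_unit_cube)
  define \<epsilon> where "\<epsilon> = r y / 2"
  have \<epsilon>: "0 < \<epsilon>" "\<epsilon> < r y" using ry by (auto simp: \<epsilon>_def)
  have "open ({x. \<epsilon> < r x} \<inter> box 0 One)"
    using r by (intro open_Int open_box open_Collect_less continuous_intros) auto
  moreover have "y \<in> {x. \<epsilon> < r x} \<inter> box 0 One" using \<epsilon> y by auto
  ultimately obtain \<delta> where \<delta>: "0 < \<delta>" "ball y \<delta> \<subseteq> {x. \<epsilon> < r x} \<inter> box 0 One"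
    by (meson openE)
  let ?K = "cbox 0 One - ball y \<delta>"
  have K: "compact ?K" by (intro compact_diff) auto
  have "\<exists>\<rho>. 0 \<le> \<rho> \<and> \<rho> < 1 \<and> (\<forall>x\<in>?K. q x \<le> \<rho>)"
  proof (cases "?K = {}")
    case False
    then obtain x0 where x0: "x0 \<in> ?K" "\<forall>x\<in>?K. q x \<le> q x0"
      using continuous_attains_sup[OF K] continuous_on_subset[OF q] by blast
    then have "x0 \<noteq> y" using \<delta> by auto
    then show ?thesis using x0 peak[of x0] q01 by auto
  qed (auto intro: exI[of _ 0])
  then obtain \<rho> where \<rho>: "0 \<le> \<rho>" "\<rho> < 1" "\<And>x. x \<in> ?K \<Longrightarrow> q x \<le> \<rho>" by blast
  \<comment> \<open>Any value strictly between \<open>\<rho>\<close> and \<open>q y = 1\<close>.\<close>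
  define \<sigma> where "\<sigma> = (1 + \<rho>) / 2"
  have \<sigma>: "0 < \<sigma>" "\<rho> < \<sigma>" "\<sigma> < 1" using \<rho> by (auto simp: \<sigma>_def)
  define V where "V = {x. \<sigma> < q x} \<inter> ball y \<delta>"
  have V: "open V" unfolding V_def using q by (intro open_Int open_Collect_less continuous_intros) auto
  have Vc: "V \<subseteq> unit_cube"
    using \<delta> by (force simp: V_def unit_cube_iff mem_box)
  have "y \<in> V" using \<sigma> qy \<delta> by (auto simp: V_def)
  then have "V \<noteq> {}" by auto
  define m where "m = measure lebesgue V"
  have mV: "measure (lebesgue_on unit_cube) V = m"
    using Vc V unfolding m_def by (simp add: measure_restrict_space)
  have "V \<in> sets (lebesgue_on unit_cube)"
    using V Vc by (auto simp: sets_restrict_space intro!: image_eqI[of _ _ V])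
  have indV: "integrable (lebesgue_on unit_cube) (indicat_real V)"
    using \<open>V \<in> sets (lebesgue_on unit_cube)\<close>
    by (intro integrable_real_indicator) (auto simp: less_top[symmetric])
  have m: "0 < m"
  proof -
    have "\<not> negligible V" using V \<open>V \<noteq> {}\<close> open_not_negligible by blast
    moreover have "V \<in> lmeasurable"
    proof (rule bounded_set_imp_lmeasurable)
      show "bounded V" unfolding V_def by (rule bounded_subset[OF bounded_ball[of y \<delta>]]) auto
    qed (use V in auto)
    ultimately show ?thesis unfolding m_def
      by (simp add: negligible_iff_measure zero_less_measure_iff)
  qed
  have "bounded (r ` cbox 0 One)"
    by (intro compact_imp_bounded compact_continuous_image continuous_on_subset[OF r]) auto
  then obtain B0 where B0: "\<And>x. x \<in> cbox 0 One \<Longrightarrow> \<bar>r x\<bar> \<le> B0" by (auto simp: bounded_iff)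
  define B where "B = max 1 B0"
  have B: "0 < B" "\<And>x. x \<in> cbox 0 One \<Longrightarrow> \<bar>r x\<bar> \<le> B" using B0 by (auto simp: B_def le_max_iff_disj)
  have key: "\<epsilon> * \<sigma> ^ n * m \<le> B * \<rho> ^ n" for n
  proof -
    have ineq: "\<epsilon> * \<sigma> ^ n * indicator V x - B * \<rho> ^ n \<le> r x * q x ^ n" if x: "x \<in> unit_cube" for x
    proof -
      have xc: "x \<in> cbox 0 One" using x unit_cube_subset_cbox by blast
      show ?thesis
      proof (cases "x \<in> ball y \<delta>")
        case True
        then have rx: "\<epsilon> < r x" using \<delta> by auto
        have "\<epsilon> * \<sigma> ^ n * indicator V x \<le> r x * q x ^ n"
        proof (cases "x \<in> V")
          case True
          then show ?thesis using rx \<epsilon> \<sigma>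
            by (auto simp: V_def intro!: mult_mono power_mono)
        qed (use rx \<epsilon> q01 in auto)
        moreover have "0 \<le> B * \<rho> ^ n" using B \<rho> by simp
        ultimately show ?thesis by simp
      next
        case False
        then have "q x ^ n \<le> \<rho> ^ n" using \<rho>(3)[of x] xc q01 by (intro power_mono) auto
        then have "\<bar>r x\<bar> * q x ^ n \<le> B * \<rho> ^ n"
          using B(2)[OF xc] q01 B(1) by (intro mult_mono) auto
        moreover have "- (\<bar>r x\<bar> * q x ^ n) \<le> r x * q x ^ n"
        proof -
          have "0 \<le> q x ^ n" using q01 by simp
          then have "- \<bar>r x\<bar> * q x ^ n \<le> r x * q x ^ n" by (intro mult_right_mono) auto
          then show ?thesis by simp
        qed
        moreover have "x \<notin> V" using False by (auto simp: V_def)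
        ultimately show ?thesis by simp
      qed
    qed
    have "integral\<^sup>L (lebesgue_on unit_cube) (\<lambda>x. \<epsilon> * \<sigma> ^ n * indicator V x - B * \<rho> ^ n)
        \<le> integral\<^sup>L (lebesgue_on unit_cube) (\<lambda>x. r x * q x ^ n)"
    proof (rule integral_mono)
      show "integrable (lebesgue_on unit_cube) (\<lambda>x. \<epsilon> * \<sigma> ^ n * indicator V x - B * \<rho> ^ n)"
        by (intro Bochner_Integration.integrable_diff integrable_mult_right indV integrable_const)
      show "integrable (lebesgue_on unit_cube) (\<lambda>x. r x * q x ^ n)"
        by (intro integrable_unit_cube continuous_intros r q)
    qed (use ineq in auto)
    also have "integral\<^sup>L (lebesgue_on unit_cube) (\<lambda>x. \<epsilon> * \<sigma> ^ n * indicator V x - B * \<rho> ^ n) =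
       \<epsilon> * \<sigma> ^ n * m - B * \<rho> ^ n"
      by (subst Bochner_Integration.integral_diff[OF integrable_mult_right[OF indV] integrable_const])
        (use Vc in \<open>simp add: mV measure_unit_cube Int_absorb1 Int_absorb2\<close>)
    finally show ?thesis using zero[of n] by simp
  qed
  obtain n where n: "(\<rho> / \<sigma>) ^ n < \<epsilon> * m / B"
    using real_arch_pow_inv[of "\<epsilon> * m / B" "\<rho> / \<sigma>"] \<epsilon> m B \<sigma> \<rho> by auto
  then have "B * \<rho> ^ n < \<epsilon> * \<sigma> ^ n * m"
    using B \<sigma> by (simp add: power_divide field_simps)
  then show False using key[of n] by simp
qed

text \<open>
  A nonnegative trigonometric polynomial in one coordinate that attains its maximum 1 exactly where
  \<open>x $ s\<close> and \<open>y $ s\<close> differ by an integer; the product over \<open>s\<close> peaks only at \<open>y\<close>, modulo 1.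
\<close>

definition peak_factor :: "real ^ 'd::finite \<Rightarrow> 'd \<Rightarrow> real ^ 'd \<Rightarrow> real"
  where "peak_factor y s x = (1 + cos (2 * pi * (x $ s - y $ s))) / 2"

lemma peak_factor_eq_trig:
  fixes y :: "real ^ 'd::finite" and s :: 'd
  defines "e \<equiv> axis s 1 :: int ^ 'd"
  shows "complex_of_real (peak_factor y s x) =
    1 / 2 + torus_character (- e) y / 4 * torus_character e x + torus_character e y / 4 * torus_character (- e) x"
proof -
  have "real_vec e \<bullet> v = v $ s" for v :: "real ^ 'd"
  proof -
    have "real_vec e = axis s 1" by (simp add: e_def real_vec_def vec_eq_iff axis_def)
    then show ?thesis by (simp add: inner_axis')
  qed
  then have t: "torus_character e v = cis (2 * pi * v $ s)" "torus_character (- e) v = cis (- (2 * pi * v $ s))" for v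
    unfolding torus_character_minus_left by (simp_all add: torus_character_def cis_conv_exp mult_ac)
  have "complex_of_real (cos u) = (cis u + cis (- u)) / 2" for u
    by (rule complex_eqI) simp_all
  moreover have "2 * pi * (x $ s - y $ s) = - (2 * pi * y $ s) + 2 * pi * x $ s"
    "- (2 * pi * (x $ s - y $ s)) = 2 * pi * y $ s + - (2 * pi * x $ s)"
    by (simp_all add: algebra_simps)
  ultimately have "complex_of_real (cos (2 * pi * (x $ s - y $ s))) =
      (cis (- (2 * pi * y $ s)) * cis (2 * pi * x $ s) + cis (2 * pi * y $ s) * cis (- (2 * pi * x $ s))) / 2"
    by (simp only: cis_mult)
  then show ?thesis unfolding t peak_factor_def by (simp add: add_divide_distrib)
qed

text \<open>
  A function whose Fourier coefficients vanish is orthogonal to all characters, hence to the product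
  of the peak factors and its powers. The point \<open>y\<close> is taken in the interior of the cube, where the peak has
  no second copy on the boundary of the cube.
\<close>

lemma fourier_uniqueness_box:
  fixes g :: "real ^ 'd::finite \<Rightarrow> complex"
  assumes g: "continuous_on UNIV g" and zero: "\<And>k. fourier_coeff g k = 0" and y: "y \<in> box 0 One"
  shows "g y = 0"
proof -
  \<comment> \<open>The functions \<open>p\<close> for which \<open>g * p\<close> has vanishing Fourier coefficients: this property is
      stable under multiplication by characters, and thus by peak factors.\<close>
  define ann where "ann p \<longleftrightarrow> continuous_on UNIV p \<and>
     (\<forall>k. integral\<^sup>L (lebesgue_on unit_cube) (\<lambda>x. g x * p x * torus_character k x) = 0)"
    for p :: "real ^ 'd \<Rightarrow> complex"
  have factor: "ann (\<lambda>x. p x * complex_of_real (peak_factor y s x))" if p: "ann p" for p s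
  proof -
    have pc: "continuous_on UNIV p" and p0: "\<And>k. integral\<^sup>L (lebesgue_on unit_cube) (\<lambda>x. g x * p x * torus_character k x) = 0"
      using p by (auto simp: ann_def)
    define e :: "int ^ 'd" where "e = axis s 1"
    define a where "a = torus_character (- e) y / 4"
    define b where "b = torus_character e y / 4"
    have int: "integrable (lebesgue_on unit_cube) (\<lambda>x. g x * p x * torus_character k x)" for k
      by (intro integrable_unit_cube continuous_intros g pc)
    have "integral\<^sup>L (lebesgue_on unit_cube) (\<lambda>x. g x * (p x * complex_of_real (peak_factor y s x)) * torus_character k x) = 0" for k
    proof -
      have "integral\<^sup>L (lebesgue_on unit_cube) (\<lambda>x. g x * (p x * complex_of_real (peak_factor y s x)) * torus_character k x)
        = integral\<^sup>L (lebesgue_on unit_cube) (\<lambda>x. 1 / 2 * (g x * p x * torus_character k x)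
            + a * (g x * p x * torus_character (e + k) x) + b * (g x * p x * torus_character (- e + k) x))"
        unfolding peak_factor_eq_trig e_def[symmetric] a_def b_def
        by (intro Bochner_Integration.integral_cong refl)
          (simp only: torus_character_add ring_distribs mult_ac)
      also have "\<dots> = 1 / 2 * 0 + a * 0 + b * 0"
        using int by (simp add: p0)
      finally show ?thesis by simp
    qed
    moreover have "continuous_on UNIV (\<lambda>x. p x * complex_of_real (peak_factor y s x))"
      unfolding peak_factor_def by (intro continuous_intros pc) auto
    ultimately show ?thesis by (simp add: ann_def)
  qed
  define q where "q x = (\<Prod>s\<in>UNIV. peak_factor y s x)" for x
  have prodS: "ann (\<lambda>x. p x * complex_of_real (\<Prod>s\<in>S. peak_factor y s x))" if "ann p" for p S
    using finite[of S] that
  proof (induction S rule: finite_induct)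
    case (insert s S)
    from factor[OF insert.IH[OF insert.prems], of s] insert.hyps show ?case by (simp add: mult_ac)
  qed simp
  have qn: "ann (\<lambda>x. complex_of_real (q x ^ n))" for n
  proof (induction n)
    case 0
    have "integral\<^sup>L (lebesgue_on unit_cube) (\<lambda>x. g x * torus_character k x) = 0" for k
      using zero[of "- k"] by (simp add: fourier_coeff_eq)
    then show ?case by (simp add: ann_def)
  next
    case (Suc n)
    from prodS[OF Suc, of UNIV] show ?case by (simp add: q_def mult.commute)
  qed
  \<comment> \<open>Rotated so that the value at \<open>y\<close> is \<open>|g y|\<^sup>2\<close>.\<close>
  define r where "r x = Re (cnj (g y) * g x)" for x
  have "r y \<le> 0"
  proof (rule nonpos_at_peak[of r q])
    show "continuous_on UNIV r" unfolding r_def by (intro continuous_intros g)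
    show "continuous_on UNIV q" unfolding q_def peak_factor_def by (intro continuous_intros) auto
    have pf: "0 \<le> peak_factor y s x" "peak_factor y s x \<le> 1" for s x
      using cos_ge_minus_one[of "2 * pi * (x $ s - y $ s)"] by (auto simp: peak_factor_def simp del: cos_ge_minus_one)
    show "0 \<le> q x" "q x \<le> 1" for x unfolding q_def by (auto intro!: prod_nonneg prod_le_1 pf)
    show "q y = 1" by (simp add: q_def peak_factor_def)
    show "y \<in> box 0 One" by (rule y)
    show "integral\<^sup>L (lebesgue_on unit_cube) (\<lambda>x. r x * q x ^ n) = 0" for n
    proof -
      have c: "continuous_on UNIV (\<lambda>x. complex_of_real (q x ^ n))"
        and "integral\<^sup>L (lebesgue_on unit_cube) (\<lambda>x. g x * complex_of_real (q x ^ n) * torus_character 0 x) = 0"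
        using qn[of n] unfolding ann_def by blast+
      then have 0: "integral\<^sup>L (lebesgue_on unit_cube) (\<lambda>x. g x * complex_of_real (q x ^ n)) = 0" by simp
      have int: "integrable (lebesgue_on unit_cube) (\<lambda>x. g x * complex_of_real (q x ^ n))"
        by (intro integrable_unit_cube continuous_intros g c)
      have "integral\<^sup>L (lebesgue_on unit_cube) (\<lambda>x. r x * q x ^ n) =
        integral\<^sup>L (lebesgue_on unit_cube) (\<lambda>x. Re (cnj (g y) * (g x * complex_of_real (q x ^ n))))"
        by (intro Bochner_Integration.integral_cong refl) (simp add: r_def algebra_simps)
      also have "\<dots> = Re (cnj (g y) * integral\<^sup>L (lebesgue_on unit_cube) (\<lambda>x. g x * complex_of_real (q x ^ n)))"
        using int by (subst integral_Re) auto
      finally show ?thesis using 0 by simp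
    qed
    fix x :: "real ^ 'd" assume x: "x \<in> cbox 0 One" "x \<noteq> y"
    then obtain s where s: "x $ s \<noteq> y $ s" by (auto simp: vec_eq_iff)
    have b: "axis s (1::real) \<in> Basis" by simp
    have "0 \<le> x \<bullet> axis s 1 \<and> x \<bullet> axis s 1 \<le> 1"
      using bspec[OF x(1)[unfolded mem_box(2)] b] b by simp
    moreover have "0 < y \<bullet> axis s 1 \<and> y \<bullet> axis s 1 < 1"
      using bspec[OF y[unfolded mem_box(1)] b] b by simp
    ultimately have d: "\<bar>x $ s - y $ s\<bar> < 1" by (simp add: inner_axis) linarith
    have "cos (2 * pi * (x $ s - y $ s)) \<noteq> 1"
    proof
      assume "cos (2 * pi * (x $ s - y $ s)) = 1"
      then obtain n :: int where "2 * pi * (x $ s - y $ s) = of_int n * 2 * pi"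
        unfolding cos_one_2pi_int by auto
      then have "x $ s - y $ s = of_int n" by simp
      with d s show False by (simp flip: of_int_abs)
    qed
    then have "peak_factor y s x < 1"
      using cos_le_one[of "2 * pi * (x $ s - y $ s)"] by (simp add: peak_factor_def del: cos_le_one)
    moreover have "q x = peak_factor y s x * (\<Prod>t\<in>UNIV - {s}. peak_factor y t x)"
      unfolding q_def by (rule prod.remove) auto
    moreover have "\<dots> \<le> peak_factor y s x * 1"
      by (intro mult_left_mono prod_le_1) (use pf in auto)
    ultimately show "q x < 1" by simp
  qed
  moreover have "r y = (norm (g y))\<^sup>2"
    using cmod_power2[of "g y"] by (simp add: r_def power2_eq_square)
  ultimately show ?thesis by simp
qed

lemma periodic_reduce:
  fixes x :: "real ^ 'd::finite"
  assumes "periodic f"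
  shows "\<exists>x'\<in>unit_cube. f x' = f x"
proof -
  define k :: "int ^ 'd" where "k = (\<chi> s. - \<lfloor>x $ s\<rfloor>)"
  have "x + real_vec k \<in> unit_cube"
    by (simp add: unit_cube_def k_def real_vec_def) (simp add: frac_def[symmetric] frac_lt_1)
  moreover have "f (x + real_vec k) = f x" using assms by (simp add: periodic_def)
  ultimately show ?thesis by blast
qed

lemma fourier_uniqueness:
  fixes g :: "real ^ 'd::finite \<Rightarrow> complex"
  assumes g: "g \<in> continuous_torus" and zero: "\<And>k. fourier_coeff g k = 0"
  shows "g x = 0"
proof -
  have c: "continuous_on UNIV g" and p: "periodic g" using g by (auto simp: continuous_torus_def)
  obtain x' where x': "x' \<in> unit_cube" "g x' = g x" using periodic_reduce[OF p] by blast
  have "closed {x. g x = 0}" by (intro closed_Collect_eq c continuous_intros)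
  moreover have "box 0 One \<subseteq> {x. g x = 0}" using fourier_uniqueness_box[OF c zero] by auto
  ultimately have "closure (box 0 One) \<subseteq> {x. g x = 0}" by (rule closure_minimal[rotated])
  moreover have "closure (box 0 (One :: real ^ 'd)) = cbox 0 One"
    by (rule closure_box) (simp add: box_ne_empty)
  moreover have "x' \<in> cbox 0 One" using x' unit_cube_subset_cbox by blast
  ultimately show ?thesis using x' by auto
qed

text \<open>
  The series converges uniformly to a continuous function \<open>S\<close>. The \<open>k\<close>-th coefficient of \<open>S\<close> differs from that of
  a finite partial sum containing \<open>k\<close> by at most the uniform distance of the two functions, so \<open>S\<close> has the same
  coefficients as \<open>f\<close>, and uniqueness applies.
\<close>

lemma fourier_series_has_sum:
  fixes f :: "real ^ 'd::finite \<Rightarrow> complex"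
  assumes f: "f \<in> continuous_torus" and sm: "(\<lambda>k. norm (fourier_coeff f k)) summable_on UNIV"
  shows "((\<lambda>k. fourier_coeff f k * torus_character k x) has_sum f x) UNIV"
proof -
  let ?c = "fourier_coeff f"
  let ?P = "\<lambda>F x. \<Sum>h\<in>F. ?c h * torus_character h x"
  define S where "S x = (\<Sum>\<^sub>\<infinity>h. ?c h * torus_character h x)" for x
  have fc: "continuous_on UNIV f" and fp: "periodic f" using f by (auto simp: continuous_torus_def)
  have ul: "uniform_limit UNIV ?P S (finite_subsets_at_top UNIV)"
    unfolding S_def by (rule Weierstrass_m_test_general[OF _ sm]) (simp add: norm_mult)
  have Pc: "continuous_on UNIV (?P F)" for F
    by (intro continuous_intros)
  have Sc: "continuous_on UNIV S"
    by (rule uniform_limit_theorem[OF always_eventually ul]) (use Pc in simp_all)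
  have Sp: "periodic S"
  proof -
    have "torus_character h (x + real_vec k) = torus_character h x" for h k :: "int ^ 'd" and x
      using periodic_torus_character[of h] by (simp add: periodic_def)
    then show ?thesis by (simp add: periodic_def S_def)
  qed
  have "fourier_coeff S k = ?c k" for k
  proof -
    have "norm (fourier_coeff S k - ?c k) \<le> \<epsilon>" if "\<epsilon> > 0" for \<epsilon>
    proof -
      have "\<forall>\<^sub>F F in finite_subsets_at_top UNIV. \<forall>x\<in>UNIV. dist (?P F x) (S x) < \<epsilon>"
        using ul that by (rule uniform_limitD)
      then obtain F0 where F0: "finite F0" "\<And>F. finite F \<Longrightarrow> F0 \<subseteq> F \<Longrightarrow> \<forall>x. dist (?P F x) (S x) < \<epsilon>"
        unfolding eventually_finite_subsets_at_top by auto
      let ?F = "insert k F0"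
      have "norm (fourier_coeff (\<lambda>x. S x - ?P ?F x) k) \<le> \<epsilon>"
      proof (rule norm_fourier_coeff_le)
        show "continuous_on UNIV (\<lambda>x. S x - ?P ?F x)" by (intro continuous_on_diff Sc Pc)
        show "norm (S x - ?P ?F x) \<le> \<epsilon>" for x
        proof -
          have "norm (?P ?F x - S x) < \<epsilon>"
            unfolding dist_norm[symmetric] using F0(1) by (intro F0(2)[rule_format]) auto
          then show ?thesis by (subst norm_minus_commute) (rule less_imp_le)
        qed
      qed
      also have "fourier_coeff (\<lambda>x. S x - ?P ?F x) k = fourier_coeff S k - fourier_coeff (?P ?F) k"
        by (rule fourier_coeff_diff[OF Sc Pc])
      also have "fourier_coeff (?P ?F) k = ?c k"
        using F0(1) by (subst fourier_coeff_trig_polynomial) auto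
      finally show ?thesis .
    qed
    then have "norm (fourier_coeff S k - ?c k) \<le> 0"
      by (rule field_le_epsilon[of _ 0, simplified])
    then show ?thesis by simp
  qed
  then have "fourier_coeff (\<lambda>x. f x - S x) k = 0" for k
    by (simp add: fourier_coeff_diff[OF fc Sc])
  moreover have "(\<lambda>x. f x - S x) \<in> continuous_torus"
    using fp Sp continuous_on_diff[OF fc Sc] by (simp add: continuous_torus_def periodic_def)
  ultimately have "f x - S x = 0"
    using fourier_uniqueness[of "\<lambda>x. f x - S x" x] by blast
  then have "f x = S x" by simp
  moreover have "(\<lambda>k. ?c k * torus_character k x) summable_on UNIV"
    by (rule abs_summable_summable) (simp add: norm_mult sm)
  ultimately show ?thesis unfolding S_def by (simp add: has_sum_infsum)
qed

section \<open>Aliasing of multiple rank-1 lattices\<close>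

text \<open>
  Reduction modulo 1 changes a node by an integer vector, which characters do not see.
\<close>

lemma torus_character_lattice_node:
  fixes h z :: "int ^ 'd::finite"
  shows "torus_character h (lattice_node z m j) =
     exp (2 * complex_of_real pi * \<i> * of_nat j * of_int (int_dot h z) / of_nat m)"
proof -
  let ?t = "real j / real m"
  define k :: "int ^ 'd" where "k = (\<chi> s. - \<lfloor>?t * real_of_int (z $ s)\<rfloor>)"
  have "lattice_node z m j = ?t *\<^sub>R real_vec z + real_vec k"
    by (simp add: vec_eq_iff lattice_node_def k_def real_vec_def frac_def)
  then have "torus_character h (lattice_node z m j) = torus_character h (?t *\<^sub>R real_vec z)"
    by (simp add: torus_character_plus torus_character_real_vec)
  then show ?thesis by (simp add: torus_character_def inner_real_vec mult_ac)
qed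

lemma sum_roots_of_unity:
  fixes a :: int and m :: nat
  assumes "m \<ge> 1"
  shows "(\<Sum>j<m. exp (2 * complex_of_real pi * \<i> * of_nat j * of_int a / of_nat m)) = (if int m dvd a then of_nat m else 0)"
proof -
  define w where "w = exp (2 * complex_of_real pi * \<i> * of_int a / of_nat m)"
  have pw: "exp (2 * complex_of_real pi * \<i> * of_nat j * of_int a / of_nat m) = w ^ j" for j
    unfolding w_def exp_of_nat_mult[symmetric] by (simp add: mult_ac)
  have "w ^ m = exp (2 * complex_of_real pi * \<i> * of_int a)"
    using pw[of m] assms by (simp add: mult_ac)
  then have wm: "w ^ m = 1" by (simp only: exp_2pi_of_int)
  have w1: "w = 1 \<longleftrightarrow> int m dvd a"
  proof
    assume "w = 1"
    then obtain n :: int where "Im (2 * complex_of_real pi * \<i> * of_int a / of_nat m) = of_int (2 * n) * pi"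
      unfolding w_def exp_eq_1 by blast
    then have "real_of_int a = real_of_int (int m * n)"
      using assms by (simp add: field_simps)
    then show "int m dvd a" by (simp only: of_int_eq_iff dvd_triv_left)
  next
    assume "int m dvd a"
    then obtain n where "a = int m * n" by (auto elim: dvdE)
    then have "2 * complex_of_real pi * \<i> * of_int a / of_nat m = 2 * complex_of_real pi * \<i> * of_int n"
      using assms by simp
    then show "w = 1" unfolding w_def by (simp only: exp_2pi_of_int)
  qed
  show ?thesis
  proof (cases "w = 1")
    case True
    then show ?thesis using w1 by (simp add: pw)
  next
    case False
    then have "(\<Sum>j<m. w ^ j) = 0" using wm by (simp add: geometric_sum)
    then show ?thesis using w1 False by (simp add: pw)
  qed
qed

lemma lattice_coeff_torus_character:
  assumes "m \<ge> 1"
  shows "lattice_coeff z m (torus_character h) k = (if [int_dot h z = int_dot k z] (mod int m) then 1 else 0)"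
proof -
  have "torus_character h (lattice_node z m j) *
      exp (- (2 * complex_of_real pi * \<i> * of_nat j * of_int (int_dot k z) / of_nat m)) =
      exp (2 * complex_of_real pi * \<i> * of_nat j * of_int (int_dot h z - int_dot k z) / of_nat m)" for j
    unfolding torus_character_lattice_node exp_add[symmetric]
    by (rule arg_cong[where f = exp]) (simp add: right_diff_distrib diff_divide_distrib)
  then have "lattice_coeff z m (torus_character h) k =
      1 / of_nat m * (if int m dvd int_dot h z - int_dot k z then of_nat m else 0)"
    unfolding lattice_coeff_def by (simp only: sum_roots_of_unity[OF assms])
  then show ?thesis
    using assms by (simp add: cong_iff_dvd_diff)
qed

lemma has_sum_finite_sum:
  fixes g :: "'a \<Rightarrow> 'b \<Rightarrow> 'c::topological_comm_monoid_add"
  assumes "finite A" "\<And>i. i \<in> A \<Longrightarrow> (g i has_sum s i) B"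
  shows "((\<lambda>x. \<Sum>i\<in>A. g i x) has_sum (\<Sum>i\<in>A. s i)) B"
  using assms by (induction A rule: finite_induct) (auto intro: has_sum_add)

text \<open>
  The computed coefficient is a finite linear combination of point values, so it may be taken under
  the sum of the series.
\<close>

lemma lattice_coeff_has_sum:
  assumes "\<And>x. ((\<lambda>h. c h * torus_character h x) has_sum f x) UNIV"
  shows "((\<lambda>h. c h * lattice_coeff z m (torus_character h) k) has_sum lattice_coeff z m f k) UNIV"
proof -
  have "((\<lambda>h. 1 / of_nat m * (\<Sum>j<m. exp (- (2 * complex_of_real pi * \<i> * of_nat j * of_int (int_dot k z) / of_nat m)) *
      (c h * torus_character h (lattice_node z m j))))
     has_sum (1 / of_nat m * (\<Sum>j<m. exp (- (2 * complex_of_real pi * \<i> * of_nat j * of_int (int_dot k z) / of_nat m)) *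
      f (lattice_node z m j)))) UNIV"
    by (intro has_sum_cmult_right has_sum_finite_sum finite_lessThan assms)
  then show ?thesis by (simp add: lattice_coeff_def sum_distrib_left mult_ac)
qed

text \<open>
  The \<open>k\<close>-th coefficient that the multiple lattice computes for the character with frequency \<open>h\<close>: the proportion,
  among the lattices that reconstruct \<open>k\<close>, of those that do not distinguish \<open>h\<close> from \<open>k\<close>.
\<close>

definition aliasing :: "(int ^ 'd::finite) set \<Rightarrow> nat \<Rightarrow> (nat \<Rightarrow> int ^ 'd) \<Rightarrow> (nat \<Rightarrow> nat) \<Rightarrow>
    int ^ 'd \<Rightarrow> int ^ 'd \<Rightarrow> real"
  where "aliasing I L z M k h =
    real (card {l \<in> alias_free_lattices I L z M k. [int_dot h (z l) = int_dot k (z l)] (mod int (M l))})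
      / real (card (alias_free_lattices I L z M k))"

lemma finite_alias_free_lattices [simp]: "finite (alias_free_lattices I L z M k)"
  by (simp add: alias_free_lattices_def)

lemma multi_lattice_coeff_has_sum:
  assumes f: "\<And>x. ((\<lambda>h. c h * torus_character h x) has_sum f x) UNIV" and M: "\<forall>l\<in>{1..L}. 1 \<le> M l"
  shows "((\<lambda>h. c h * complex_of_real (aliasing I L z M k h)) has_sum multi_lattice_coeff I L z M f k) UNIV"
proof -
  let ?A = "alias_free_lattices I L z M k"
  have "((\<lambda>h. 1 / of_nat (card ?A) * (\<Sum>l\<in>?A. c h * lattice_coeff (z l) (M l) (torus_character h) k))
     has_sum multi_lattice_coeff I L z M f k) UNIV"
    unfolding multi_lattice_coeff_def
    by (intro has_sum_cmult_right has_sum_finite_sum finite_alias_free_lattices lattice_coeff_has_sum f)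
  moreover have "1 / of_nat (card ?A) * (\<Sum>l\<in>?A. c h * lattice_coeff (z l) (M l) (torus_character h) k) =
     c h * complex_of_real (aliasing I L z M k h)" for h
  proof -
    have "(\<Sum>l\<in>?A. lattice_coeff (z l) (M l) (torus_character h) k) =
      (\<Sum>l\<in>?A. if [int_dot h (z l) = int_dot k (z l)] (mod int (M l)) then 1 else 0)"
      using M by (intro sum.cong refl lattice_coeff_torus_character) (auto simp: alias_free_lattices_def)
    also have "\<dots> = of_nat (card {l \<in> ?A. [int_dot h (z l) = int_dot k (z l)] (mod int (M l))})"
      by (simp add: sum.If_cases Int_def)
    finally show ?thesis by (simp add: aliasing_def flip: sum_distrib_left)
  qed
  ultimately show ?thesis by simp
qed

lemma aliasing_nonneg: "0 \<le> aliasing I L z M k h"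
  by (simp add: aliasing_def)

text \<open>
  A lattice that reconstructs \<open>k\<close> distinguishes it from all other frequencies in \<open>I\<close>.
\<close>

lemma aliasing_inside:
  assumes "reconstruction_property I L z M" "k \<in> I" "h \<in> I"
  shows "aliasing I L z M k h = (if h = k then 1 else 0)"
proof -
  let ?A = "alias_free_lattices I L z M k"
  have "?A \<noteq> {}"
  proof -
    have "k \<in> (\<Union>l\<in>{1..L}. alias_free I (z l) (M l))"
      using assms(1,2) by (simp only: reconstruction_property_def)
    then show ?thesis by (auto simp: alias_free_lattices_def)
  qed
  moreover have "{l \<in> ?A. [int_dot h (z l) = int_dot k (z l)] (mod int (M l))} = (if h = k then ?A else {})"
    using assms(3) by (auto simp: alias_free_lattices_def alias_free_def dest: cong_sym)
  ultimately show ?thesis by (simp add: aliasing_def)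
qed

text \<open>
  Bound the proportion by the number of lattices and exchange the sums. For a fixed lattice there is at
  most one \<open>k\<close>: two frequencies reconstructed by the lattice and aliasing with \<open>h\<close> alias with each other.
\<close>

lemma sum_aliasing_le:
  assumes I: "finite I"
  shows "(\<Sum>k\<in>I. aliasing I L z M k h) \<le> real L"
proof -
  let ?P = "\<lambda>k l. k \<in> alias_free I (z l) (M l) \<and> [int_dot h (z l) = int_dot k (z l)] (mod int (M l))"
  have "(\<Sum>k\<in>I. aliasing I L z M k h) \<le> (\<Sum>k\<in>I. \<Sum>l\<in>{1..L}. of_bool (?P k l))"
  proof (rule sum_mono)
    fix k
    let ?A = "alias_free_lattices I L z M k"
    let ?B = "{l \<in> ?A. [int_dot h (z l) = int_dot k (z l)] (mod int (M l))}"
    have "aliasing I L z M k h \<le> real (card ?B)"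
    proof (cases "card ?A = 0")
      case False
      then have 1: "1 \<le> real (card ?A)" by linarith
      have "real (card ?B) / real (card ?A) \<le> real (card ?B) / 1"
        by (rule divide_left_mono) (use 1 in linarith)+
      then show ?thesis by (simp add: aliasing_def)
    qed (simp add: aliasing_def)
    also have "?B = {l \<in> {1..L}. ?P k l}" by (auto simp: alias_free_lattices_def)
    also have "real (card \<dots>) = (\<Sum>l\<in>{1..L}. of_bool (?P k l))"
      by (simp add: of_bool_def sum.If_cases Int_def)
    finally show "aliasing I L z M k h \<le> (\<Sum>l\<in>{1..L}. of_bool (?P k l))" .
  qed
  also have "\<dots> = (\<Sum>l\<in>{1..L}. \<Sum>k\<in>I. of_bool (?P k l))" by (rule sum.swap)
  also have "\<dots> \<le> (\<Sum>l\<in>{1..L}. 1)"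
  proof (rule sum_mono)
    fix l
    have "card {k \<in> I. ?P k l} \<le> Suc 0"
    proof (subst card_le_Suc0_iff_eq)
      show "\<forall>k\<in>{k \<in> I. ?P k l}. \<forall>k'\<in>{k \<in> I. ?P k l}. k = k'"
      proof (intro ballI)
        fix k k' assume k: "k \<in> {k \<in> I. ?P k l}" and k': "k' \<in> {k \<in> I. ?P k l}"
        then have "[int_dot k (z l) = int_dot k' (z l)] (mod int (M l))"
          using cong_trans cong_sym by blast
        then show "k = k'" using k k' by (auto simp: alias_free_def)
      qed
    qed (use I in simp)
    then show "(\<Sum>k\<in>I. of_bool (?P k l)) \<le> (1::real)"
      using I by (simp add: of_bool_def sum.If_cases Int_def)
  qed
  finally show ?thesis by simp
qed

lemma card_alias_free_le:
  assumes "m \<ge> 1"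
  shows "finite (alias_free I z m)" "card (alias_free I z m) \<le> m"
proof -
  have inj: "inj_on (\<lambda>k. int_dot k z mod int m) (alias_free I z m)"
  proof (rule inj_onI)
    fix k k' assume "k \<in> alias_free I z m" "k' \<in> alias_free I z m" "int_dot k z mod int m = int_dot k' z mod int m"
    then show "k = k'" by (auto simp: alias_free_def cong_def)
  qed
  have sub: "(\<lambda>k. int_dot k z mod int m) ` alias_free I z m \<subseteq> {0..<int m}"
    using assms by auto
  show "finite (alias_free I z m)" using inj sub by (meson finite_atLeastLessThan_int inj_on_finite)
  show "card (alias_free I z m) \<le> m" using card_inj_on_le[OF inj sub] by simp
qed

lemma card_le_number_of_samples:
  assumes "reconstruction_property I L z M" "\<forall>l\<in>{1..L}. 1 \<le> M l"
  shows "card I \<le> (\<Sum>l=1..L. M l)"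
proof -
  have "card I = card (\<Union>l\<in>{1..L}. alias_free I (z l) (M l))"
    using assms(1) by (simp add: reconstruction_property_def)
  also have "\<dots> \<le> (\<Sum>l=1..L. card (alias_free I (z l) (M l)))" by (rule card_UN_le) simp
  also have "\<dots> \<le> (\<Sum>l=1..L. M l)" using assms(2) by (intro sum_mono card_alias_free_le) auto
  finally show ?thesis .
qed

lemma sampling_op_eq:
  "sampling_op I L z M f = (\<lambda>x. \<Sum>k\<in>I. multi_lattice_coeff I L z M f k * torus_character k x)"
  by (simp add: fun_eq_iff sampling_op_def torus_character_def)

lemma continuous_on_sampling_op: "continuous_on UNIV (sampling_op I L z M f)"
  unfolding sampling_op_eq
  by (intro continuous_on_sum continuous_on_mult continuous_on_const continuous_on_torus_character)

lemma sampling_error_continuous_torus: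
  assumes "f \<in> continuous_torus"
  shows "(\<lambda>x. f x - sampling_op I L z M f x) \<in> continuous_torus"
proof -
  have p: "torus_character h (x + real_vec k) = torus_character h x" for h k :: "int ^ 'a" and x
    using periodic_torus_character[of h] by (simp add: periodic_def)
  have "continuous_on UNIV (\<lambda>x. f x - sampling_op I L z M f x)"
    using assms by (intro continuous_on_diff continuous_on_sampling_op) (auto simp: continuous_torus_def)
  then show ?thesis
    using assms by (simp add: continuous_torus_def periodic_def sampling_op_eq p)
qed

lemma fourier_coeff_sampling_error:
  assumes "f \<in> continuous_torus" "finite I"
  shows "fourier_coeff (\<lambda>x. f x - sampling_op I L z M f x) k =
    fourier_coeff f k - (if k \<in> I then multi_lattice_coeff I L z M f k else 0)"
proof -
  have "fourier_coeff (\<lambda>x. f x - sampling_op I L z M f x) k = fourier_coeff f k - fourier_coeff (sampling_op I L z M f) k"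
    using assms by (intro fourier_coeff_diff continuous_on_sampling_op) (auto simp: continuous_torus_def)
  also have "fourier_coeff (sampling_op I L z M f) k = (if k \<in> I then multi_lattice_coeff I L z M f k else 0)"
    unfolding sampling_op_eq by (rule fourier_coeff_trig_polynomial) (rule assms)
  finally show ?thesis .
qed

text \<open>
  Outside \<open>I\<close> the coefficients of the error are those of \<open>f\<close>. For \<open>k\<close> in \<open>I\<close>, the exact part cancels and
  leaves, up to sign, the sum of the coefficients of \<open>f\<close> at \<open>h \<notin> I\<close>, weighted by the aliasing factors; summing over \<open>k\<close> first bounds the
  total by \<open>L\<close> times the tail.
\<close>

lemma sampling_error_le_tail:
  fixes f :: "real ^ 'd::finite \<Rightarrow> complex"
  assumes f: "f \<in> continuous_torus" and sm: "(\<lambda>k. norm (fourier_coeff f k)) summable_on UNIV"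
    and I: "finite I" and rp: "reconstruction_property I L z M" and M: "\<forall>l\<in>{1..L}. 1 \<le> M l"
  shows "\<exists>E. ((\<lambda>k. norm (fourier_coeff (\<lambda>x. f x - sampling_op I L z M f x) k)) has_sum E) UNIV \<and>
    E \<le> (1 + real L) * (\<Sum>\<^sub>\<infinity>k\<in>- I. norm (fourier_coeff f k))"
proof -
  let ?c = "fourier_coeff f" and ?a = "aliasing I L z M" and ?b = "multi_lattice_coeff I L z M f"
  let ?e = "\<lambda>k. norm (fourier_coeff (\<lambda>x. f x - sampling_op I L z M f x) k)"
  define Q where "Q = (\<Sum>\<^sub>\<infinity>k\<in>- I. norm (?c k))"
  have smI: "(\<lambda>k. norm (?c k)) summable_on - I" using sm by (rule summable_on_subset) auto
  then have Q: "((\<lambda>k. norm (?c k)) has_sum Q) (- I)" unfolding Q_def by (rule has_sum_infsum)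
  have a_le: "?a k h \<le> real L" if "k \<in> I" for k h
  proof -
    have "?a k h \<le> (\<Sum>k\<in>I. ?a k h)" using that I by (intro member_le_sum) (auto simp: aliasing_nonneg)
    then show ?thesis using sum_aliasing_le[OF I, of L z M h] by linarith
  qed
  define T where "T k = (\<Sum>\<^sub>\<infinity>h\<in>- I. norm (?c h) * ?a k h)" for k
  have T: "((\<lambda>h. norm (?c h) * ?a k h) has_sum T k) (- I)" if "k \<in> I" for k
    unfolding T_def
  proof (rule has_sum_infsum, rule summable_on_comparison_test)
    show "(\<lambda>h. norm (?c h) * real L) summable_on - I" using smI by (rule summable_on_cmult_left)
  qed (auto intro!: mult_left_mono a_le that simp: aliasing_nonneg)
  have eT: "?e k \<le> T k" if k: "k \<in> I" for k
  proof -
    have "((\<lambda>h. ?c h * complex_of_real (?a k h)) has_sum ?b k) UNIV"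
      by (rule multi_lattice_coeff_has_sum[OF fourier_series_has_sum[OF f sm] M])
    moreover have "((\<lambda>h. ?c h * complex_of_real (?a k h)) has_sum ?c k) I"
    proof (rule has_sum_finiteI[OF I])
      have "(\<Sum>h\<in>I. ?c h * complex_of_real (?a k h)) = (\<Sum>h\<in>I. if h = k then ?c h else 0)"
        using k by (intro sum.cong refl) (simp add: aliasing_inside[OF rp])
      then show "?c k = (\<Sum>h\<in>I. ?c h * complex_of_real (?a k h))" using I k by simp
    qed
    ultimately have "((\<lambda>h. ?c h * complex_of_real (?a k h)) has_sum (?b k - ?c k)) (- I)"
      unfolding Compl_eq_Diff_UNIV by (rule has_sum_Diff) simp
    then have "norm (?b k - ?c k) \<le> T k"
      using T[OF k] by (rule norm_infsum_le) (simp add: norm_mult aliasing_nonneg)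
    then show ?thesis
      using k by (simp add: fourier_coeff_sampling_error[OF f I] norm_minus_commute)
  qed
  have "(\<Sum>k\<in>I. T k) \<le> Q * real L"
  proof (rule has_sum_mono)
    show "((\<lambda>h. \<Sum>k\<in>I. norm (?c h) * ?a k h) has_sum (\<Sum>k\<in>I. T k)) (- I)"
      by (rule has_sum_finite_sum[OF I T])
    show "((\<lambda>h. norm (?c h) * real L) has_sum (Q * real L)) (- I)"
      using Q by (rule has_sum_cmult_left)
    show "(\<Sum>k\<in>I. norm (?c h) * ?a k h) \<le> norm (?c h) * real L" for h
      unfolding sum_distrib_left[symmetric] by (intro mult_left_mono sum_aliasing_le I) auto
  qed
  moreover have "(\<Sum>k\<in>I. ?e k) \<le> (\<Sum>k\<in>I. T k)" by (intro sum_mono eT)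
  ultimately have "(\<Sum>k\<in>I. ?e k) + Q \<le> (1 + real L) * Q" by (simp add: algebra_simps)
  moreover have "(?e has_sum ((\<Sum>k\<in>I. ?e k) + Q)) (I \<union> - I)"
  proof (rule has_sum_Un_disjoint)
    show "(?e has_sum (\<Sum>k\<in>I. ?e k)) I" using I by (rule has_sum_finite)
    have "(?e has_sum Q) (- I) \<longleftrightarrow> ((\<lambda>k. norm (?c k)) has_sum Q) (- I)"
      by (rule has_sum_cong) (simp add: fourier_coeff_sampling_error[OF f I])
    then show "(?e has_sum Q) (- I)" using Q by simp
  qed simp
  ultimately show ?thesis unfolding Q_def by auto
qed

section \<open>Absolutely summable series and the two norms\<close>

lemma infsum_ennreal_eq:
  assumes "(g has_sum s) A" "\<And>x. x \<in> A \<Longrightarrow> 0 \<le> g x"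
  shows "(\<Sum>\<^sub>\<infinity>x\<in>A. ennreal (g x)) = ennreal s"
proof -
  have "g summable_on A" "infsum g A = s" using assms(1) by (simp_all add: has_sum_iff)
  then have "ennreal s = (SUP F\<in>{F. finite F \<and> F \<subseteq> A}. ennreal (sum g F))"
    using infsum_nonneg_is_SUPREMUM_ennreal[of g A] assms(2) by simp
  also have "\<dots> = (SUP F\<in>{F. finite F \<and> F \<subseteq> A}. \<Sum>x\<in>F. ennreal (g x))"
    using assms(2) by (intro SUP_cong refl sum_ennreal[symmetric]) auto
  also have "\<dots> = (\<Sum>\<^sub>\<infinity>x\<in>A. ennreal (g x))"
    by (rule nonneg_infsum_complete[symmetric]) simp
  finally show ?thesis by simp
qed

lemma summable_on_of_infsum_ennreal:
  assumes "(\<Sum>\<^sub>\<infinity>x\<in>A. ennreal (g x)) < \<infinity>" "\<And>x. x \<in> A \<Longrightarrow> 0 \<le> g x"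
  shows "g summable_on A"
proof -
  obtain r where r: "0 \<le> r" "(\<Sum>\<^sub>\<infinity>x\<in>A. ennreal (g x)) = ennreal r"
    using assms(1) by (cases "\<Sum>\<^sub>\<infinity>x\<in>A. ennreal (g x)") auto
  have "sum g F \<le> r" if "finite F" "F \<subseteq> A" for F
  proof -
    have "ennreal (sum g F) = (\<Sum>x\<in>F. ennreal (g x))"
      using assms(2) that by (intro sum_ennreal[symmetric]) auto
    also have "\<dots> \<le> (SUP F\<in>{F. finite F \<and> F \<subseteq> A}. \<Sum>x\<in>F. ennreal (g x))"
      using that by (intro SUP_upper) auto
    also have "\<dots> = ennreal r"
      unfolding r(2)[symmetric] by (rule nonneg_infsum_complete[symmetric]) simp
    finally show ?thesis using r(1) by (simp add: ennreal_le_iff)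
  qed
  then show ?thesis
    using assms(2)
    by (intro nonneg_bounded_partial_sums_imp_summable_on[where C = r] eventually_finite_subsets_at_top_weakI) auto
qed

text \<open>
  Characters have modulus 1, so the Fourier series bounds the function at every point.
\<close>

lemma Linf_norm_le_wiener_norm:
  fixes g :: "real ^ 'd::finite \<Rightarrow> complex"
  assumes g: "g \<in> continuous_torus" and E: "((\<lambda>k. norm (fourier_coeff g k)) has_sum E) UNIV"
  shows "Linf_norm g \<le> ennreal E"
  unfolding Linf_norm_def
proof (rule esssup_I)
  have c: "continuous_on UNIV g" using g by (simp add: continuous_torus_def)
  have "g \<in> borel_measurable (lebesgue_on unit_cube)"
    by (rule continuous_imp_measurable_on_sets_lebesgue) (auto intro: continuous_on_subset[OF c])
  then show "(\<lambda>x. ennreal (norm (g x))) \<in> borel_measurable (lebesgue_on unit_cube)" by measurable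
  have "norm (g x) \<le> E" for x
  proof (rule norm_has_sum_bound)
    show "((\<lambda>k. fourier_coeff g k * torus_character k x) has_sum g x) UNIV"
      by (rule fourier_series_has_sum[OF g has_sum_imp_summable[OF E]])
    show "((\<lambda>k. norm (fourier_coeff g k * torus_character k x)) has_sum E) UNIV"
      using E by (simp add: norm_mult)
  qed
  then show "AE x in lebesgue_on unit_cube. ennreal (norm (g x)) \<le> ennreal E"
    by (intro AE_I2 ennreal_leI)
qed

lemma weight_0_0 [simp]: "weight 0 0 k = 1"
proof -
  have "max 1 (one_norm k) \<noteq> 0" "max 1 \<bar>real_of_int (k $ s)\<bar> \<noteq> 0" for s by linarith+
  then show ?thesis by (simp add: weight_def)
qed

lemma wiener_norm_0_0_eq:
  assumes "((\<lambda>k. norm (fourier_coeff g k)) has_sum E) UNIV"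
  shows "wiener_norm 0 0 g = ennreal E"
  unfolding wiener_norm_def using infsum_ennreal_eq[OF assms] by simp

text \<open>
  On the complement of \<open>I\<close> the weight exceeds \<open>R\<close>. Together with the finiteness of \<open>I\<close> this also shows that
  the unweighted coefficients are summable.
\<close>

lemma tail_le_weighted_norm:
  fixes f :: "real ^ 'd::finite \<Rightarrow> complex"
  assumes f: "f \<in> wiener_space \<alpha> \<beta>" and I: "finite I" and R: "0 < R" "\<And>k. k \<notin> I \<Longrightarrow> R < weight \<alpha> \<beta> k"
  shows "\<exists>W\<ge>0. wiener_norm \<alpha> \<beta> f = ennreal W \<and> (\<lambda>k. norm (fourier_coeff f k)) summable_on UNIV \<and>
    (\<Sum>\<^sub>\<infinity>k\<in>- I. norm (fourier_coeff f k)) \<le> 1 / R * W"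
proof -
  let ?c = "\<lambda>k. norm (fourier_coeff f k)" and ?w = "\<lambda>k. weight \<alpha> \<beta> k * norm (fourier_coeff f k)"
  have w0: "0 \<le> ?w k" for k using weight_pos[of \<alpha> \<beta> k] by simp
  have ws: "?w summable_on UNIV"
    using f w0 by (intro summable_on_of_infsum_ennreal) (auto simp: wiener_space_def wiener_norm_def)
  define W where "W = infsum ?w UNIV"
  have W: "(?w has_sum W) UNIV" unfolding W_def using ws by (rule has_sum_infsum)
  have W0: "0 \<le> W" unfolding W_def by (intro infsum_nonneg w0)
  have wI: "?w summable_on - I" using ws by (rule summable_on_subset) auto
  have le: "?c k \<le> 1 / R * ?w k" if "k \<in> - I" for k
  proof -
    have "R * ?c k \<le> ?w k" using R(2)[of k] that by (intro mult_right_mono) auto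
    then show ?thesis using R(1) by (simp add: field_simps)
  qed
  have cs: "(\<lambda>k. 1 / R * ?w k) summable_on - I" using wI by (rule summable_on_cmult_right)
  have cI: "?c summable_on - I" by (rule summable_on_comparison_test[OF cs le]) auto
  then have "?c summable_on (I \<union> - I)" using I by (intro summable_on_union) auto
  then have "?c summable_on UNIV" by simp
  moreover have "infsum ?c (- I) \<le> 1 / R * W"
  proof -
    have "infsum ?c (- I) \<le> (\<Sum>\<^sub>\<infinity>k\<in>- I. 1 / R * ?w k)" by (rule infsum_mono[OF cI cs le])
    also have "\<dots> = 1 / R * infsum ?w (- I)" by (rule infsum_cmult_right[OF wI])
    also have "infsum ?w (- I) \<le> W" unfolding W_def by (rule infsum_mono2[OF wI ws]) (use w0 in auto)
    finally show ?thesis using R(1) by (simp add: divide_right_mono)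
  qed
  moreover have "wiener_norm \<alpha> \<beta> f = ennreal W"
    unfolding wiener_norm_def by (rule infsum_ennreal_eq[OF W w0])
  ultimately show ?thesis using W0 by blast
qed

section \<open>The cut-off expressed by the number of samples\<close>

lemma powr_le_powr_iff:
  fixes a x y :: real
  assumes "0 < a" "0 \<le> x" "0 \<le> y"
  shows "x powr a \<le> y powr a \<longleftrightarrow> x \<le> y"
  using powr_mono2[of a x y] powr_less_mono2[of a y x] assms by linarith

text \<open>
  For \<open>\<beta> > 0\<close>, the weight of the function space is the weight in the definition of the index set raised to
  the power \<open>\<beta>\<close>, and \<open>(1 - T) * \<beta> = \<alpha> + \<beta>\<close>.
\<close>

lemma index_set_eq:
  assumes "0 \<le> \<beta>" "- \<beta> < \<alpha>" "1 \<le> N"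
  shows "index_set N (shape \<alpha> \<beta>) = {k. weight \<alpha> \<beta> k \<le> N powr (\<alpha> + \<beta>)}"
proof (cases "\<beta> = 0")
  case True
  have "max 1 (one_norm k) \<le> N \<longleftrightarrow> weight \<alpha> \<beta> k \<le> N powr (\<alpha> + \<beta>)" for k :: "int ^ 'a"
  proof -
    have "0 < (\<Prod>s\<in>UNIV. truncated_abs (k $ s))" by (intro prod_pos) (auto simp: truncated_abs_pos)
    then have "(\<Prod>s\<in>UNIV. truncated_abs (k $ s)) powr 0 = 1" by (metis powr_zero_eq_one less_irrefl)
    then have "weight \<alpha> \<beta> k = max 1 (one_norm k) powr \<alpha>" unfolding weight_eq True by simp
    then show ?thesis
      using powr_le_powr_iff[of \<alpha> "max 1 (one_norm k)" N] assms True by simp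
  qed
  then show ?thesis using True by (simp add: index_set_def shape_def)
next
  case False
  then have \<beta>: "0 < \<beta>" using assms by simp
  have "weight (\<alpha> / \<beta>) 1 k \<le> N powr (1 + \<alpha> / \<beta>) \<longleftrightarrow> weight \<alpha> \<beta> k \<le> N powr (\<alpha> + \<beta>)" for k :: "int ^ 'a"
  proof -
    have "weight (\<alpha> / \<beta>) 1 k powr \<beta> = weight \<alpha> \<beta> k"
      unfolding weight_eq powr_mult powr_powr using \<beta> by simp
    moreover have "(N powr (1 + \<alpha> / \<beta>)) powr \<beta> = N powr (\<alpha> + \<beta>)"
    proof -
      have "(1 + \<alpha> / \<beta>) * \<beta> = \<alpha> + \<beta>" using \<beta> by (simp add: distrib_right)
      then show ?thesis by (simp only: powr_powr)
    qed
    ultimately show ?thesis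
      using powr_le_powr_iff[of \<beta> "weight (\<alpha> / \<beta>) 1 k" "N powr (1 + \<alpha> / \<beta>)"] \<beta> weight_pos[of "\<alpha> / \<beta>" 1 k] by simp
  qed
  then show ?thesis using False by (simp add: index_set_def shape_def)
qed

text \<open>
  In the application, \<open>K\<close> is the number of frequencies, \<open>u = ln m / m\<close> for \<open>m\<close> samples, and \<open>R\<close> is the cut-off.
\<close>

lemma inverse_le_rate_of_power_bound:
  fixes R K u e C0 c :: real
  assumes "0 < R" "0 < K" "0 < e" "0 < C0" "K \<le> C0 * R powr (1 / e)" "1 / K \<le> c * u" "0 < c" "0 < u"
  shows "1 / R \<le> (C0 * c) powr e * u powr e"
proof -
  have "1 / R powr (1 / e) \<le> C0 / K"
    using assms by (simp add: field_simps)
  also have "\<dots> \<le> C0 * (c * u)"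
    using assms mult_left_mono[of "1 / K" "c * u" C0] by simp
  finally have "(1 / R powr (1 / e)) powr e \<le> (C0 * (c * u)) powr e"
    using assms by (intro powr_mono2) auto
  moreover have "(1 / R powr (1 / e)) powr e = 1 / R"
    using assms by (simp add: powr_divide powr_powr)
  ultimately show ?thesis using assms by (simp add: powr_mult mult_ac)
qed

text \<open>
  For \<open>\<alpha> \<noteq> 0\<close> the number of frequencies is bounded by a multiple of a power of the cut-off, and inverting
  this bound gives the rate. For
  \<open>\<alpha> = 0\<close> the count contains a power of \<open>ln N\<close>, which has to be replaced by \<open>ln m\<close>. If \<open>N \<le> m\<close> this is
  immediate, and if \<open>N > m\<close> then \<open>1 / N < 1 / m\<close>, and \<open>1 / m\<close> is at most a multiple of the claimed rate.
\<close>

lemma cutoff_le_rate: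
  assumes "0 \<le> \<beta>" "- \<beta> < \<alpha>" "0 < c"
  shows "\<exists>D>0. \<forall>N\<ge>1. \<forall>m\<ge>2. \<forall>F :: (int ^ 'd::finite) set. finite F \<longrightarrow> F \<noteq> {} \<longrightarrow>
    (\<forall>k\<in>F. weight \<alpha> \<beta> k \<le> N powr (\<alpha> + \<beta>)) \<longrightarrow> m \<le> c * (real (card F) * ln m) \<longrightarrow>
    1 / N powr (\<alpha> + \<beta>) \<le> D *
      (if \<alpha> > 0 then (ln m / m) powr (\<alpha> / real CARD('d) + \<beta>)
       else if \<alpha> = 0 then ((ln m) ^ CARD('d) / m) powr \<beta>
       else (ln m / m) powr (\<alpha> + \<beta>))"
proof -
  have K: "0 < real (card F) \<and> 1 / real (card F) \<le> c * (ln m / m)"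
    if "2 \<le> m" "finite F" "F \<noteq> {}" "m \<le> c * (real (card F) * ln m)" for m and F :: "(int ^ 'd) set"
  proof -
    have "0 < real (card F)" using that by (simp add: card_gt_0_iff)
    then show ?thesis using that by (simp add: field_simps)
  qed
  have u: "0 < ln m / m" if "2 \<le> m" for m :: real using that by simp
  consider "\<alpha> > 0" | "\<alpha> = 0" | "\<alpha> < 0" by linarith
  then show ?thesis
  proof cases
    case 1
    define e where "e = \<alpha> / real CARD('d) + \<beta>"
    have e: "0 < e" using 1 assms unfolding e_def by (intro add_pos_nonneg) (auto simp: zero_less_divide_iff)
    obtain C0 where C0: "0 < C0" "\<And>R F. 1 \<le> R \<Longrightarrow> finite F \<Longrightarrow> (\<And>k. k\<in>F \<Longrightarrow> weight \<alpha> \<beta> (k :: int ^ 'd) \<le> R) \<Longrightarrow>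
        real (card F) \<le> C0 * R powr (1 / e)"
      using card_weight_le_pos[where 'd = 'd, OF 1 assms(1)] unfolding e_def by metis
    show ?thesis
    proof (intro exI[of _ "(C0 * c) powr e"] conjI allI impI)
      show "0 < (C0 * c) powr e" using C0 assms by simp
      fix N m :: real and F :: "(int ^ 'd) set"
      assume N: "1 \<le> N" and m: "2 \<le> m" and F: "finite F" "F \<noteq> {}" "\<forall>k\<in>F. weight \<alpha> \<beta> k \<le> N powr (\<alpha> + \<beta>)"
        and mK: "m \<le> c * (real (card F) * ln m)"
      have R: "1 \<le> N powr (\<alpha> + \<beta>)" using N assms by (intro ge_one_powr_ge_zero) auto
      have "1 / N powr (\<alpha> + \<beta>) \<le> (C0 * c) powr e * (ln m / m) powr e"
        by (rule inverse_le_rate_of_power_bound[of _ "real (card F)"])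
          (use R F K[OF m F(1,2) mK] u[OF m] e C0 assms N in auto)
      then show "1 / N powr (\<alpha> + \<beta>) \<le> (C0 * c) powr e * (if \<alpha> > 0 then (ln m / m) powr (\<alpha> / real CARD('d) + \<beta>)
         else if \<alpha> = 0 then ((ln m) ^ CARD('d) / m) powr \<beta> else (ln m / m) powr (\<alpha> + \<beta>))"
        using 1 by (simp add: e_def)
    qed
  next
    case 3
    define e where "e = \<alpha> + \<beta>"
    have e: "0 < e" using assms unfolding e_def by simp
    obtain C0 where C0: "0 < C0" "\<And>N F. 1 \<le> N \<Longrightarrow> finite F \<Longrightarrow> (\<And>k. k\<in>F \<Longrightarrow> weight \<alpha> \<beta> (k :: int ^ 'd) \<le> N powr e) \<Longrightarrow>
        real (card F) \<le> C0 * N"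
      using card_weight_le_neg[where 'd = 'd, OF 3 assms(2)] unfolding e_def by metis
    show ?thesis
    proof (intro exI[of _ "(C0 * c) powr e"] conjI allI impI)
      show "0 < (C0 * c) powr e" using C0 assms by simp
      fix N m :: real and F :: "(int ^ 'd) set"
      assume N: "1 \<le> N" and m: "2 \<le> m" and F: "finite F" "F \<noteq> {}" "\<forall>k\<in>F. weight \<alpha> \<beta> k \<le> N powr (\<alpha> + \<beta>)"
        and mK: "m \<le> c * (real (card F) * ln m)"
      have "real (card F) \<le> C0 * (N powr e) powr (1 / e)"
        using C0(2)[OF N F(1)] F(3) e N by (simp add: e_def[symmetric] powr_powr)
      then have "1 / N powr e \<le> (C0 * c) powr e * (ln m / m) powr e"
        by (intro inverse_le_rate_of_power_bound[of _ "real (card F)"])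
          (use F K[OF m F(1,2) mK] u[OF m] e C0 assms N in auto)
      then show "1 / N powr (\<alpha> + \<beta>) \<le> (C0 * c) powr e * (if \<alpha> > 0 then (ln m / m) powr (\<alpha> / real CARD('d) + \<beta>)
         else if \<alpha> = 0 then ((ln m) ^ CARD('d) / m) powr \<beta> else (ln m / m) powr (\<alpha> + \<beta>))"
        using 3 by (simp add: e_def)
    qed
  next
    case 2
    then have \<beta>: "0 < \<beta>" using assms by simp
    obtain C0 where C0: "0 < C0" "\<And>N F. 1 \<le> N \<Longrightarrow> finite F \<Longrightarrow> (\<And>k. k\<in>F \<Longrightarrow> weight 0 \<beta> (k :: int ^ 'd) \<le> N powr \<beta>) \<Longrightarrow>
        real (card F) \<le> C0 * N * (1 + ln N) ^ (CARD('d) - 1)"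
      using card_weight_le_mixed[where 'd = 'd, OF \<beta>] by metis
    \<comment> \<open>As \<open>m \<ge> 2\<close>, this gives \<open>1 + ln m \<le> \<kappa> * ln m\<close>.\<close>
    define \<kappa> where "\<kappa> = 1 + 1 / ln (2::real)"
    define C1 where "C1 = C0 * \<kappa> ^ (CARD('d) - 1) * c + (1 / ln 2) ^ CARD('d)"
    have \<kappa>: "0 < \<kappa>" by (simp add: \<kappa>_def add_pos_pos)
    have C1: "0 < C1" unfolding C1_def using C0 \<kappa> assms by (intro add_pos_pos) auto
    show ?thesis
    proof (intro exI[of _ "C1 powr \<beta>"] conjI allI impI)
      show "0 < C1 powr \<beta>" using C1 by simp
      fix N m :: real and F :: "(int ^ 'd) set"
      assume N: "1 \<le> N" and m: "2 \<le> m" and F: "finite F" "F \<noteq> {}" "\<forall>k\<in>F. weight \<alpha> \<beta> k \<le> N powr (\<alpha> + \<beta>)"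
        and mK: "m \<le> c * (real (card F) * ln m)"
      have lnm: "ln 2 \<le> ln m" "0 < ln m" using m by auto
      let ?v = "(ln m) ^ CARD('d) / m"
      have v: "0 < ?v" using lnm m by simp
      have "1 / N \<le> C1 * ?v"
      proof (cases "N \<le> m")
        case True
        have "1 + ln N \<le> \<kappa> * ln m"
        proof -
          have "1 \<le> ln m / ln 2" using lnm by simp
          moreover have "ln N \<le> ln m" using True N by simp
          moreover have "\<kappa> * ln m = ln m + ln m / ln 2" by (simp add: \<kappa>_def distrib_right)
          ultimately show ?thesis by linarith
        qed
        moreover have "0 \<le> 1 + ln N" using N by (simp add: add_nonneg_nonneg)
        ultimately have p: "(1 + ln N) ^ (CARD('d) - 1) \<le> (\<kappa> * ln m) ^ (CARD('d) - 1)"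
          by (intro power_mono)
        have "real (card F) \<le> C0 * N * (1 + ln N) ^ (CARD('d) - 1)"
          using F 2 by (intro C0(2) N) auto
        also have "\<dots> \<le> C0 * N * (\<kappa> * ln m) ^ (CARD('d) - 1)"
          using p C0 N by (intro mult_left_mono) auto
        finally have "1 / N \<le> C0 * (\<kappa> * ln m) ^ (CARD('d) - 1) * (1 / real (card F))"
          using N K[OF m F(1,2) mK] by (simp add: field_simps)
        also have "\<dots> \<le> C0 * (\<kappa> * ln m) ^ (CARD('d) - 1) * (c * (ln m / m))"
          using K[OF m F(1,2) mK] C0 \<kappa> lnm by (intro mult_left_mono) auto
        also have "\<dots> = C0 * \<kappa> ^ (CARD('d) - 1) * c * ((ln m ^ (CARD('d) - 1) * ln m) / m)"
          by (simp add: power_mult_distrib)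
        also have "ln m ^ (CARD('d) - 1) * ln m = ln m ^ CARD('d)"
          by (rule power_minus_mult) simp
        also have "C0 * \<kappa> ^ (CARD('d) - 1) * c * ?v \<le> C1 * ?v"
          using v unfolding C1_def by (intro mult_right_mono) auto
        finally show ?thesis .
      next
        case False
        then have "1 / N \<le> 1 / m" using m by (intro divide_left_mono) auto
        also have "1 \<le> (ln m / ln 2) ^ CARD('d)" using lnm by (intro one_le_power) simp
        then have "1 / m \<le> (ln m / ln 2) ^ CARD('d) / m" using m by (intro divide_right_mono) auto
        also have "(ln m / ln 2) ^ CARD('d) / m = (1 / ln 2) ^ CARD('d) * ?v"
          by (simp add: power_divide)
        also have "\<dots> \<le> C1 * ?v"
          using v C0 \<kappa> assms unfolding C1_def by (intro mult_right_mono) auto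
        finally show ?thesis .
      qed
      then have "(1 / N) powr \<beta> \<le> (C1 * ?v) powr \<beta>" using N \<beta> by (intro powr_mono2) auto
      then have "1 / N powr \<beta> \<le> C1 powr \<beta> * ?v powr \<beta>"
        by (simp only: powr_divide powr_mult powr_one_eq_one)
      then show "1 / N powr (\<alpha> + \<beta>) \<le> C1 powr \<beta> * (if \<alpha> > 0 then (ln m / m) powr (\<alpha> / real CARD('d) + \<beta>)
         else if \<alpha> = 0 then ((ln m) ^ CARD('d) / m) powr \<beta> else (ln m / m) powr (\<alpha> + \<beta>))"
        using 2 by simp
    qed
  qed
qed

section \<open>The sampling error\<close>

theorem corollary3p3:
  fixes \<alpha> \<beta> c\<^sub>L c\<^sub>M :: real
  assumes "\<beta> \<ge> 0" and "\<alpha> > - \<beta>" and "c\<^sub>L > 0" and "c\<^sub>M > 0"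
  shows "\<exists>C > 0. \<forall>(N::real) (f :: real ^ 'd::finite \<Rightarrow> complex)
      (L::nat) (z :: nat \<Rightarrow> int ^ 'd) (M :: nat \<Rightarrow> nat).
    let I = index_set N (shape \<alpha> \<beta>);
        M\<^sub>t = real (\<Sum>l=1..L. M l);
        err = (\<lambda>x. f x - sampling_op I L z M f x)
    in N \<ge> 1 \<longrightarrow>
       f \<in> wiener_space \<alpha> \<beta> \<inter> continuous_torus \<longrightarrow>
       L \<ge> 1 \<longrightarrow>
       (\<forall>l\<in>{1..L}. M l \<ge> 1) \<longrightarrow>
       reconstruction_property I L z M \<longrightarrow>
       real L \<le> c\<^sub>L * ln (real (card I)) \<longrightarrow>
       M\<^sub>t \<le> c\<^sub>M * (real (card I) * ln (real (card I))) \<longrightarrow>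
       Linf_norm err \<le> wiener_norm 0 0 err \<and>
       wiener_norm 0 0 err \<le> ennreal C * wiener_norm \<alpha> \<beta> f * ennreal (ln M\<^sub>t *
         (if \<alpha> > 0 then (ln M\<^sub>t / M\<^sub>t) powr (\<alpha> / real CARD('d) + \<beta>)
          else if \<alpha> = 0 then ((ln M\<^sub>t) ^ CARD('d) / M\<^sub>t) powr \<beta>
          else (ln M\<^sub>t / M\<^sub>t) powr (\<alpha> + \<beta>)))"
proof -
  define rate where "rate m =
     (if \<alpha> > 0 then (ln m / m) powr (\<alpha> / real CARD('d) + \<beta>)
      else if \<alpha> = 0 then ((ln m) ^ CARD('d) / m) powr \<beta>
      else (ln m / m) powr (\<alpha> + \<beta>))" for m :: real
  obtain D where D: "0 < D" "\<And>N m (F :: (int ^ 'd) set). \<lbrakk>1 \<le> N; 2 \<le> m; finite F; F \<noteq> {};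
      \<And>k. k \<in> F \<Longrightarrow> weight \<alpha> \<beta> k \<le> N powr (\<alpha> + \<beta>); m \<le> c\<^sub>M * (real (card F) * ln m)\<rbrakk> \<Longrightarrow>
      1 / N powr (\<alpha> + \<beta>) \<le> D * rate m"
    using cutoff_le_rate[where 'd = 'd, OF assms(1,2,4)] unfolding rate_def by metis
  show ?thesis
    unfolding Let_def rate_def[symmetric]
  proof (intro exI[of _ "2 * c\<^sub>L * D"] conjI[of "0 < 2 * c\<^sub>L * D"] allI impI)
    show "0 < 2 * c\<^sub>L * D" using D(1) assms by simp
    fix N :: real and f :: "real ^ 'd \<Rightarrow> complex" and L :: nat and z :: "nat \<Rightarrow> int ^ 'd" and M :: "nat \<Rightarrow> nat"
    define I :: "(int ^ 'd) set" where "I = index_set N (shape \<alpha> \<beta>)"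
    define m where "m = real (\<Sum>l=1..L. M l)"
    define err where "err = (\<lambda>x. f x - sampling_op I L z M f x)"
    assume N: "1 \<le> N" and f: "f \<in> wiener_space \<alpha> \<beta> \<inter> continuous_torus" and L1: "1 \<le> L"
      and M: "\<forall>l\<in>{1..L}. 1 \<le> M l"
      and "reconstruction_property (index_set N (shape \<alpha> \<beta>)) L z M"
      and "real L \<le> c\<^sub>L * ln (real (card (index_set N (shape \<alpha> \<beta>) :: (int ^ 'd) set)))"
      and "real (\<Sum>l=1..L. M l) \<le> c\<^sub>M * (real (card (index_set N (shape \<alpha> \<beta>) :: (int ^ 'd) set)) *
         ln (real (card (index_set N (shape \<alpha> \<beta>) :: (int ^ 'd) set))))"
    then have rp: "reconstruction_property I L z M" and L: "real L \<le> c\<^sub>L * ln (real (card I))"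
      and mI: "m \<le> c\<^sub>M * (real (card I) * ln (real (card I)))"
      by (simp_all only: I_def m_def)
    have I_eq: "I = {k. weight \<alpha> \<beta> k \<le> N powr (\<alpha> + \<beta>)}"
      unfolding I_def by (rule index_set_eq) (use assms N in auto)
    \<comment> \<open>The bound on \<open>L \<ge> 1\<close> excludes that \<open>card I\<close> is 0 or 1; in particular \<open>I\<close> is finite, because
        infinite sets have cardinality 0.\<close>
    have "0 < c\<^sub>L * ln (real (card I))" using L L1 by linarith
    then have lnK: "0 < ln (real (card I))" using assms(3) by (simp add: zero_less_mult_iff)
    then have K: "2 \<le> card I"
      by (cases "card I = 0 \<or> card I = 1") auto
    then have I: "finite I" "I \<noteq> {}" by (auto intro: card_ge_0_finite)
    have Km: "real (card I) \<le> m" unfolding m_def of_nat_le_iff by (rule card_le_number_of_samples[OF rp M])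
    then have m: "2 \<le> m" and ln_le: "ln (real (card I)) \<le> ln m" using K by auto
    have "m \<le> c\<^sub>M * (real (card I) * ln m)"
      using mI ln_le assms(4) by (smt (verit) mult_left_mono of_nat_0_le_iff)
    then have rate: "1 / N powr (\<alpha> + \<beta>) \<le> D * rate m"
      using I N m by (intro D(2)[of N m I]) (auto simp: I_eq)
    obtain W where W: "0 \<le> W" "wiener_norm \<alpha> \<beta> f = ennreal W"
        "(\<lambda>k. norm (fourier_coeff f k)) summable_on UNIV"
        "(\<Sum>\<^sub>\<infinity>k\<in>- I. norm (fourier_coeff f k)) \<le> 1 / N powr (\<alpha> + \<beta>) * W"
      using tail_le_weighted_norm[of f \<alpha> \<beta> I "N powr (\<alpha> + \<beta>)"] f I N by (auto simp: I_eq)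
    obtain E where E: "((\<lambda>k. norm (fourier_coeff err k)) has_sum E) UNIV"
        "E \<le> (1 + real L) * (\<Sum>\<^sub>\<infinity>k\<in>- I. norm (fourier_coeff f k))"
      using sampling_error_le_tail[OF _ W(3) I(1) rp M] f unfolding err_def by blast
    have err: "err \<in> continuous_torus"
      unfolding err_def using f by (intro sampling_error_continuous_torus) auto
    have "1 + real L \<le> 2 * c\<^sub>L * ln m"
    proof -
      have "c\<^sub>L * ln (real (card I)) \<le> c\<^sub>L * ln m" using ln_le assms(3) by simp
      then show ?thesis using L L1 by simp
    qed
    have r0: "0 \<le> rate m" by (simp add: rate_def)
    have "E \<le> (1 + real L) * (1 / N powr (\<alpha> + \<beta>) * W)"
      using E(2) W(4) by (meson mult_left_mono order_trans of_nat_0_le_iff add_nonneg_nonneg zero_le_one)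
    also have "\<dots> \<le> (2 * c\<^sub>L * ln m) * (D * rate m * W)"
      using \<open>1 + real L \<le> 2 * c\<^sub>L * ln m\<close> rate W(1) assms(3) m
      by (intro mult_mono mult_right_mono) auto
    also have "\<dots> = 2 * c\<^sub>L * D * W * (ln m * rate m)" by simp
    finally have "ennreal E \<le> ennreal (2 * c\<^sub>L * D * W * (ln m * rate m))" by (rule ennreal_leI)
    also have "\<dots> = ennreal (2 * c\<^sub>L * D) * ennreal W * ennreal (ln m * rate m)"
      using D(1) W(1) assms(3) r0 m by (simp add: ennreal_mult[symmetric] del: ennreal_mult'')
    finally have "wiener_norm 0 0 err \<le> ennreal (2 * c\<^sub>L * D) * wiener_norm \<alpha> \<beta> f * ennreal (ln m * rate m)"
      unfolding wiener_norm_0_0_eq[OF E(1)] W(2) .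
    moreover have "Linf_norm err \<le> wiener_norm 0 0 err"
      unfolding wiener_norm_0_0_eq[OF E(1)] by (rule Linf_norm_le_wiener_norm[OF err E(1)])
    ultimately show "Linf_norm (\<lambda>x. f x - sampling_op (index_set N (shape \<alpha> \<beta>)) L z M f x)
          \<le> wiener_norm 0 0 (\<lambda>x. f x - sampling_op (index_set N (shape \<alpha> \<beta>)) L z M f x) \<and>
        wiener_norm 0 0 (\<lambda>x. f x - sampling_op (index_set N (shape \<alpha> \<beta>)) L z M f x)
          \<le> ennreal (2 * c\<^sub>L * D) * wiener_norm \<alpha> \<beta> f *
            ennreal (ln (real (\<Sum>l=1..L. M l)) * rate (real (\<Sum>l=1..L. M l)))"
      unfolding err_def I_def m_def by blast
  qed
qed

end
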